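(* Let $(W,S)$ be a Coxeter system with set of reflections $T$, and let $\Lambda$, $N$, $\Phi$ be the conjugation action on $T$, the reflection cocycle and the abstract root system of $(W,S)$. (a) The triple $\mathcal C_{(W,S)}:=(W,\wp_W(\Lambda),N)$ is a principal rootoid with $S$ as its set of simple generators (i.e. simple morphisms). It is complete if and only if $W$ is finite. (b) $\mathcal C'_{(W,S)}:=(W,\Lambda,N)$ is a (principal) set rootoid. (c) The (principal, rootoidal) signed groupoid-set $\mathfrak K(\mathcal C'_{(W,S)})$ is isomorphic to the standard signed groupoid-set $C_{(W,S)}:=(W,\Phi)$ of $(W,S)$.
   Context: Coxeter data. Let $(W,S)$ be a Coxeter system with length function $l=l_S$ and reflections $T=\{wsw^{-1}\mid w\in W,s\in S\}$. $W$ is regarded as a groupoid with one object. $\Lambda\colon W\to\mathbf{Set}$ is the functor given by the conjugation action of $W$ on $T$; $\wp_W(\Lambda)$ is the induced action of $W$ on the Boolean ring $\wp(T)$ of subsets of $T$ (addition is symmetric difference, product is intersection). The reflection cocycle $N\colon W\to\wp(T)$ is $N(w)=\{t\in T\mid l(tw)<l(w)\}$; it is known to satisfy $N(xy)=N(x)+xN(y)x^{-1}$. The abstract root system is $\Phi=T\times\{\pm\}$ with $\{\pm\}$ acting by multiplication on the second factor, positive roots $\Phi_+=T\times\{+\}$, and $W$-action $w(t,\epsilon)=(wtw^{-1},\nu\epsilon)$ with $\nu=+$ if $l(wt)>l(w)$ and $\nu=-$ if $l(wt)<l(w)$; it is regarded as a functor $W\to\mathbf{Set}_\pm$ (see below).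 Protorootoids. For a groupoid $G$, ${}_aG_b=\mathrm{Hom}_G(b,a)$, ${}_aG$ is the set of morphisms with codomain $a$, $g^*=g^{-1}$. A Boolean ring is a possibly non-unital ring with all elements idempotent, ordered by $x\subseteq y\iff xy=x$; $x\cap y=xy$, $\emptyset=0$. A protorootoid is a triple $(G,\Lambda,N)$ with $G$ a groupoid, $\Lambda$ a functor from $G$ to Boolean rings, and $N$ assigning to each $g\in{}_aG$ an element $N(g)\in\Lambda(a)$ with $N(gh)=N(g)+\Lambda(g)(N(h))$ whenever $gh$ is defined. The weak order at $a$ is the subposet ${}_a\mathcal L=\{N(g)\mid g\in{}_aG\}$ of $\Lambda(a)$. The protorootoid is complete if every ${}_a\mathcal L$ is a complete lattice. It is a rootoid if: (i) for $g,h\in{}_aG$, $N(g)=N(h)$ implies $g=h$; (ii) each ${}_a\mathcal L$ is a complete meet semilattice (every non-empty subset has a meet); (iii) if $A_i,A\in{}_a\mathcal L$ with $A_i\cap A=\emptyset$ for all $i$ and the join $B=\bigvee_iA_i$ exists in ${}_a\mathcal L$, then $B\cap A=\emptyset$. A morphism $s\in{}_aG$ is simple if $N(s)$ is an atom of the Boolean ring $\Lambda(a)$. An element $x$ of a Boolean ring $B$ has finite rank if $xB$ is finite, and its rank is then the number of atoms of $xB$. A protorootoid is principal if all $N(g)$ have finite rank, the set $S'$ of simple morphisms generates $G$, and for every $g$ the minimal length $l_{S'}(g)$ of $g$ as a product of elements of $S'\cup S'^{*}$ ($0$ for identities) equals $\mathrm{rank}(N(g))$. Set protorootoids. A set protorootoid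 is a triple $(G,\Lambda,N)$ with $\Lambda\colon G\to\mathbf{Set}$ a functor such that $(G,\wp_G(\Lambda),N)$ is a protorootoid, where $\wp_G(\Lambda)(a)=\wp(\Lambda(a))$ with morphisms of $G$ acting by images of subsets. It is called principal, or a set rootoid, when $(G,\wp_G(\Lambda),N)$ is principal, respectively a rootoid. Signed groupoid-sets. A definitely signed set is a set $\Theta$ with a free $\{\pm\}$-action and a specified set $\Theta_+$ of orbit representatives; $\mathbf{Set}_\pm$ is the category of these with all $\{\pm\}$-equivariant maps. A signed groupoid-set is a pair $(G,\Phi)$ of a groupoid $G$ and a functor $\Phi\colon G\to\mathbf{Set}_\pm$. A morphism $(G,\Phi)\to(H,\Psi)$ is a pair $(\alpha,\nu)$ of a functor $\alpha\colon G\to H$ and a natural transformation $\nu\colon\Psi\alpha\to\Phi$ whose components map positive elements to positive elements; composition is $(\beta,\mu)(\alpha,\nu)=(\beta\alpha,\nu(\mu\alpha))$. For a set protorootoid $(G,\Lambda,N)$, $\mathfrak K(G,\Lambda,N)=(G,\Phi)$ where $\Phi(a)=\Lambda(a)\times\{\pm\}$, with $\{\pm\}$ acting on the second factor and $\Phi(a)_+=\Lambda(a)\times\{+\}$, and for $g\in{}_aG_b$, $\Phi(g)(x,\epsilon)=(\Lambda(g)(x),\epsilon\epsilon')$ with $\epsilon'=-$ if $x\in N(g^* )$ and $\epsilon'=+$ otherwise. For a signed groupoid-set $(G,\Phi)$, put $\Lambda(a)=\Phi(a)/\{\pm\}$ with induced $G$-action, and for $g\in{}_aG_b$ let $N(g)$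 be the image in $\Lambda(a)$ of $\Phi(a)_+\cap\Phi(g)(-\Phi(b)_+)$; then $(G,\Lambda,N)$ is a set protorootoid and $(G,\Phi)$ is called principal, rootoidal, etc. when $(G,\wp_G(\Lambda),N)$ is principal, a rootoid, etc. *)

theory Defs
  imports "HOL-Algebra.Complete_Lattice" "HOL-Algebra.Multiplicative_Group"
begin

section \<open>Groupoids\<close>

text \<open>
  \<open>Comp G g h\<close> is the composite \<open>gh\<close> ("first \<open>h\<close>, then \<open>g\<close>"); it is meaningful
  exactly when \<open>Dom G g = Cod G h\<close>.
\<close>

record ('o, 'm) groupoid =
  Obj :: "'o set"
  Mor :: "'m set"
  Dom :: "'m \<Rightarrow> 'o"
  Cod :: "'m \<Rightarrow> 'o"
  Ident :: "'o \<Rightarrow> 'm"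
  Comp :: "'m \<Rightarrow> 'm \<Rightarrow> 'm"

definition gpd_inverse :: "('o, 'm) groupoid \<Rightarrow> 'm \<Rightarrow> 'm \<Rightarrow> bool" where
  "gpd_inverse G g h \<longleftrightarrow>
     h \<in> Mor G \<and> Dom G h = Cod G g \<and> Cod G h = Dom G g \<and>
     Comp G h g = Ident G (Dom G g) \<and> Comp G g h = Ident G (Cod G g)"

definition is_groupoid :: "('o, 'm) groupoid \<Rightarrow> bool" where
  "is_groupoid G \<longleftrightarrow>
     (\<forall>g\<in>Mor G. Dom G g \<in> Obj G \<and> Cod G g \<in> Obj G) \<and>
     (\<forall>a\<in>Obj G. Ident G a \<in> Mor G \<and> Dom G (Ident G a) = a \<and> Cod G (Ident G a) = a) \<and>
     (\<forall>g\<in>Mor G. \<forall>h\<in>Mor G. Dom G g = Cod G h \<longrightarrow>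
        Comp G g h \<in> Mor G \<and> Dom G (Comp G g h) = Dom G h \<and> Cod G (Comp G g h) = Cod G g) \<and>
     (\<forall>g\<in>Mor G. \<forall>h\<in>Mor G. \<forall>k\<in>Mor G. Dom G g = Cod G h \<and> Dom G h = Cod G k \<longrightarrow>
        Comp G (Comp G g h) k = Comp G g (Comp G h k)) \<and>
     (\<forall>g\<in>Mor G. Comp G g (Ident G (Dom G g)) = g \<and> Comp G (Ident G (Cod G g)) g = g) \<and>
     (\<forall>g\<in>Mor G. \<exists>h. gpd_inverse G g h)"

definition gpd_inv :: "('o, 'm) groupoid \<Rightarrow> 'm \<Rightarrow> 'm" where
  "gpd_inv G g = (THE h. gpd_inverse G g h)"

definition star_of :: "('o, 'm) groupoid \<Rightarrow> 'o \<Rightarrow> 'm set" where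
  "star_of G a = {g \<in> Mor G. Cod G g = a}"

text \<open>
  \<open>product_of G X n g\<close>: \<open>g\<close> is a composite of \<open>n\<close> morphisms from \<open>X\<close>; composites of
  \<open>0\<close> morphisms are the identities.
\<close>

inductive product_of :: "('o, 'm) groupoid \<Rightarrow> 'm set \<Rightarrow> nat \<Rightarrow> 'm \<Rightarrow> bool"
  for G X where
  ident: "a \<in> Obj G \<Longrightarrow> product_of G X 0 (Ident G a)"
| step: "x \<in> X \<Longrightarrow> product_of G X n g \<Longrightarrow> Dom G x = Cod G g \<Longrightarrow>
         product_of G X (Suc n) (Comp G x g)"

definition gpd_generates :: "('o, 'm) groupoid \<Rightarrow> 'm set \<Rightarrow> bool" where
  "gpd_generates G X \<longleftrightarrow>
     X \<subseteq> Mor G \<and> (\<forall>g\<in>Mor G. \<exists>n. product_of G (X \<union> gpd_inv G ` X) n g)"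

definition gpd_length :: "('o, 'm) groupoid \<Rightarrow> 'm set \<Rightarrow> 'm \<Rightarrow> nat" where
  "gpd_length G X g = (LEAST n. product_of G (X \<union> gpd_inv G ` X) n g)"


section \<open>Boolean rings\<close>

text \<open>
  Boolean rings need not be unital: the field \<open>one\<close> of the ring record carries no meaning here.
\<close>

locale boolean_ring = abelian_group R for R (structure) +
  assumes m_closed: "\<lbrakk>x \<in> carrier R; y \<in> carrier R\<rbrakk> \<Longrightarrow> x \<otimes> y \<in> carrier R"
    and m_assoc: "\<lbrakk>x \<in> carrier R; y \<in> carrier R; z \<in> carrier R\<rbrakk> \<Longrightarrow>
                  (x \<otimes> y) \<otimes> z = x \<otimes> (y \<otimes> z)"
    and l_distr: "\<lbrakk>x \<in> carrier R; y \<in> carrier R; z \<in> carrier R\<rbrakk> \<Longrightarrow>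
                  (x \<oplus> y) \<otimes> z = x \<otimes> z \<oplus> y \<otimes> z"
    and r_distr: "\<lbrakk>x \<in> carrier R; y \<in> carrier R; z \<in> carrier R\<rbrakk> \<Longrightarrow>
                  z \<otimes> (x \<oplus> y) = z \<otimes> x \<oplus> z \<otimes> y"
    and idem: "x \<in> carrier R \<Longrightarrow> x \<otimes> x = x"

definition br_hom :: "'x ring \<Rightarrow> 'x ring \<Rightarrow> ('x \<Rightarrow> 'x) \<Rightarrow> bool" where
  "br_hom R R' f \<longleftrightarrow>
     (\<forall>x\<in>carrier R. f x \<in> carrier R') \<and>
     (\<forall>x\<in>carrier R. \<forall>y\<in>carrier R.
        f (x \<oplus>\<^bsub>R\<^esub> y) = f x \<oplus>\<^bsub>R'\<^esub> f y \<and> f (x \<otimes>\<^bsub>R\<^esub> y) = f x \<otimes>\<^bsub>R'\<^esub> f y)"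

definition br_le :: "'x ring \<Rightarrow> 'x \<Rightarrow> 'x \<Rightarrow> bool" where
  "br_le R x y \<longleftrightarrow> x \<otimes>\<^bsub>R\<^esub> y = x"

definition br_atoms :: "'x ring \<Rightarrow> 'x set" where
  "br_atoms R = {x \<in> carrier R. x \<noteq> \<zero>\<^bsub>R\<^esub> \<and>
     (\<forall>y\<in>carrier R. br_le R y x \<longrightarrow> y = \<zero>\<^bsub>R\<^esub> \<or> y = x)}"

definition br_principal :: "'x ring \<Rightarrow> 'x \<Rightarrow> 'x set" where
  "br_principal R x = {x \<otimes>\<^bsub>R\<^esub> y | y. y \<in> carrier R}"

definition br_finite_rank :: "'x ring \<Rightarrow> 'x \<Rightarrow> bool" where
  "br_finite_rank R x \<longleftrightarrow> finite (br_principal R x)"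

definition br_rank :: "'x ring \<Rightarrow> 'x \<Rightarrow> nat" where
  "br_rank R x = card (br_atoms (R\<lparr>carrier := br_principal R x\<rparr>))"

definition powerset_ring :: "'x set \<Rightarrow> 'x set ring" where
  "powerset_ring A =
     \<lparr>carrier = Pow A, mult = (\<inter>), one = A, zero = {}, add = (\<lambda>X Y. (X - Y) \<union> (Y - X))\<rparr>"


section \<open>Protorootoids\<close>

record ('o, 'm, 'x) protorootoid =
  Gpd :: "('o, 'm) groupoid"
  Lam_ob :: "'o \<Rightarrow> 'x ring"
  Lam_mor :: "'m \<Rightarrow> 'x \<Rightarrow> 'x"
  Coc :: "'m \<Rightarrow> 'x"

definition is_br_functor ::
    "('o, 'm) groupoid \<Rightarrow> ('o \<Rightarrow> 'x ring) \<Rightarrow> ('m \<Rightarrow> 'x \<Rightarrow> 'x) \<Rightarrow> bool" where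
  "is_br_functor G L l \<longleftrightarrow>
     (\<forall>a\<in>Obj G. boolean_ring (L a)) \<and>
     (\<forall>g\<in>Mor G. br_hom (L (Dom G g)) (L (Cod G g)) (l g)) \<and>
     (\<forall>a\<in>Obj G. \<forall>x\<in>carrier (L a). l (Ident G a) x = x) \<and>
     (\<forall>g\<in>Mor G. \<forall>h\<in>Mor G. Dom G g = Cod G h \<longrightarrow>
        (\<forall>x\<in>carrier (L (Dom G h)). l (Comp G g h) x = l g (l h x)))"

definition is_protorootoid :: "('o, 'm, 'x) protorootoid \<Rightarrow> bool" where
  "is_protorootoid P \<longleftrightarrow>
     is_groupoid (Gpd P) \<and>
     is_br_functor (Gpd P) (Lam_ob P) (Lam_mor P) \<and>
     (\<forall>g\<in>Mor (Gpd P). Coc P g \<in> carrier (Lam_ob P (Cod (Gpd P) g))) \<and>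
     (\<forall>g\<in>Mor (Gpd P). \<forall>h\<in>Mor (Gpd P). Dom (Gpd P) g = Cod (Gpd P) h \<longrightarrow>
        Coc P (Comp (Gpd P) g h) =
          Coc P g \<oplus>\<^bsub>Lam_ob P (Cod (Gpd P) g)\<^esub> Lam_mor P g (Coc P h))"

definition weak_order :: "('o, 'm, 'x) protorootoid \<Rightarrow> 'o \<Rightarrow> 'x gorder" where
  "weak_order P a =
     \<lparr>carrier = Coc P ` star_of (Gpd P) a, eq = (=), le = br_le (Lam_ob P a)\<rparr>"

definition is_complete :: "('o, 'm, 'x) protorootoid \<Rightarrow> bool" where
  "is_complete P \<longleftrightarrow> (\<forall>a\<in>Obj (Gpd P). complete_lattice (weak_order P a))"

definition complete_meet_semilattice :: "'x gorder \<Rightarrow> bool" where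
  "complete_meet_semilattice L \<longleftrightarrow>
     partial_order L \<and>
     (\<forall>A. A \<subseteq> carrier L \<and> A \<noteq> {} \<longrightarrow> (\<exists>i. greatest L i (Lower L A)))"

definition is_rootoid :: "('o, 'm, 'x) protorootoid \<Rightarrow> bool" where
  "is_rootoid P \<longleftrightarrow>
     is_protorootoid P \<and>
     (\<forall>a\<in>Obj (Gpd P).
        inj_on (Coc P) (star_of (Gpd P) a) \<and>
        complete_meet_semilattice (weak_order P a) \<and>
        (\<forall>X A B. X \<subseteq> carrier (weak_order P a) \<and> A \<in> carrier (weak_order P a) \<and>
           (\<forall>Y\<in>X. Y \<otimes>\<^bsub>Lam_ob P a\<^esub> A = \<zero>\<^bsub>Lam_ob P a\<^esub>) \<and>
           least (weak_order P a) B (Upper (weak_order P a) X) \<longrightarrow>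
           B \<otimes>\<^bsub>Lam_ob P a\<^esub> A = \<zero>\<^bsub>Lam_ob P a\<^esub>))"

definition simple_morphisms :: "('o, 'm, 'x) protorootoid \<Rightarrow> 'm set" where
  "simple_morphisms P =
     {s \<in> Mor (Gpd P). Coc P s \<in> br_atoms (Lam_ob P (Cod (Gpd P) s))}"

definition is_principal :: "('o, 'm, 'x) protorootoid \<Rightarrow> bool" where
  "is_principal P \<longleftrightarrow>
     is_protorootoid P \<and>
     (\<forall>g\<in>Mor (Gpd P). br_finite_rank (Lam_ob P (Cod (Gpd P) g)) (Coc P g)) \<and>
     gpd_generates (Gpd P) (simple_morphisms P) \<and>
     (\<forall>g\<in>Mor (Gpd P). gpd_length (Gpd P) (simple_morphisms P) g =
        br_rank (Lam_ob P (Cod (Gpd P) g)) (Coc P g))"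


section \<open>Set protorootoids\<close>

record ('o, 'm, 'x) set_protorootoid =
  SGpd :: "('o, 'm) groupoid"
  SLam_ob :: "'o \<Rightarrow> 'x set"
  SLam_mor :: "'m \<Rightarrow> 'x \<Rightarrow> 'x"
  SCoc :: "'m \<Rightarrow> 'x set"

definition is_set_functor ::
    "('o, 'm) groupoid \<Rightarrow> ('o \<Rightarrow> 'x set) \<Rightarrow> ('m \<Rightarrow> 'x \<Rightarrow> 'x) \<Rightarrow> bool" where
  "is_set_functor G L l \<longleftrightarrow>
     (\<forall>g\<in>Mor G. \<forall>x\<in>L (Dom G g). l g x \<in> L (Cod G g)) \<and>
     (\<forall>a\<in>Obj G. \<forall>x\<in>L a. l (Ident G a) x = x) \<and>
     (\<forall>g\<in>Mor G. \<forall>h\<in>Mor G. Dom G g = Cod G h \<longrightarrow>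
        (\<forall>x\<in>L (Dom G h). l (Comp G g h) x = l g (l h x)))"

definition powerset_protorootoid ::
    "('o, 'm, 'x) set_protorootoid \<Rightarrow> ('o, 'm, 'x set) protorootoid" where
  "powerset_protorootoid P =
     \<lparr>Gpd = SGpd P, Lam_ob = (\<lambda>a. powerset_ring (SLam_ob P a)),
      Lam_mor = (\<lambda>g X. SLam_mor P g ` X), Coc = SCoc P\<rparr>"

definition is_set_protorootoid :: "('o, 'm, 'x) set_protorootoid \<Rightarrow> bool" where
  "is_set_protorootoid P \<longleftrightarrow>
     is_groupoid (SGpd P) \<and> is_set_functor (SGpd P) (SLam_ob P) (SLam_mor P) \<and>
     is_protorootoid (powerset_protorootoid P)"

definition is_principal_set_protorootoid :: "('o, 'm, 'x) set_protorootoid \<Rightarrow> bool" where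
  "is_principal_set_protorootoid P \<longleftrightarrow>
     is_set_protorootoid P \<and> is_principal (powerset_protorootoid P)"

definition is_set_rootoid :: "('o, 'm, 'x) set_protorootoid \<Rightarrow> bool" where
  "is_set_rootoid P \<longleftrightarrow>
     is_set_protorootoid P \<and> is_rootoid (powerset_protorootoid P)"


section \<open>Signed groupoid-sets\<close>

datatype pm = Pls | Mns

fun pm_mult :: "pm \<Rightarrow> pm \<Rightarrow> pm" where
  "pm_mult Pls e = e"
| "pm_mult Mns Pls = Mns"
| "pm_mult Mns Mns = Pls"

record 'x signed_set =
  scarrier :: "'x set"
  sact :: "pm \<Rightarrow> 'x \<Rightarrow> 'x"
  spos :: "'x set"

definition sorbit :: "'x signed_set \<Rightarrow> 'x \<Rightarrow> 'x set" where
  "sorbit \<Theta> x = {sact \<Theta> e x | e. True}"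

definition definitely_signed_set :: "'x signed_set \<Rightarrow> bool" where
  "definitely_signed_set \<Theta> \<longleftrightarrow>
     (\<forall>x\<in>scarrier \<Theta>.
        (\<forall>e. sact \<Theta> e x \<in> scarrier \<Theta>) \<and>
        sact \<Theta> Pls x = x \<and>
        (\<forall>e f. sact \<Theta> (pm_mult e f) x = sact \<Theta> e (sact \<Theta> f x)) \<and>
        (\<forall>e. sact \<Theta> e x = x \<longrightarrow> e = Pls) \<and>
        (\<exists>!y. y \<in> sorbit \<Theta> x \<inter> spos \<Theta>)) \<and>
     spos \<Theta> \<subseteq> scarrier \<Theta>"

definition equivariant :: "'x signed_set \<Rightarrow> 'y signed_set \<Rightarrow> ('x \<Rightarrow> 'y) \<Rightarrow> bool" where
  "equivariant \<Theta> \<Theta>' f \<longleftrightarrow>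
     (\<forall>x\<in>scarrier \<Theta>. f x \<in> scarrier \<Theta>' \<and> (\<forall>e. f (sact \<Theta> e x) = sact \<Theta>' e (f x)))"

record ('o, 'm, 'x) signed_groupoid_set =
  SgGpd :: "('o, 'm) groupoid"
  Phi_ob :: "'o \<Rightarrow> 'x signed_set"
  Phi_mor :: "'m \<Rightarrow> 'x \<Rightarrow> 'x"

definition is_signed_groupoid_set :: "('o, 'm, 'x) signed_groupoid_set \<Rightarrow> bool" where
  "is_signed_groupoid_set X \<longleftrightarrow>
     is_groupoid (SgGpd X) \<and>
     (\<forall>a\<in>Obj (SgGpd X). definitely_signed_set (Phi_ob X a)) \<and>
     (\<forall>g\<in>Mor (SgGpd X).
        equivariant (Phi_ob X (Dom (SgGpd X) g)) (Phi_ob X (Cod (SgGpd X) g)) (Phi_mor X g)) \<and>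
     is_set_functor (SgGpd X) (\<lambda>a. scarrier (Phi_ob X a)) (Phi_mor X)"

definition sgs_set_protorootoid ::
    "('o, 'm, 'x) signed_groupoid_set \<Rightarrow> ('o, 'm, 'x set) set_protorootoid" where
  "sgs_set_protorootoid X =
     \<lparr>SGpd = SgGpd X,
      SLam_ob = (\<lambda>a. sorbit (Phi_ob X a) ` scarrier (Phi_ob X a)),
      SLam_mor = (\<lambda>g Q. Phi_mor X g ` Q),
      SCoc = (\<lambda>g.
        let \<Phi>a = Phi_ob X (Cod (SgGpd X) g); \<Phi>b = Phi_ob X (Dom (SgGpd X) g)
        in sorbit \<Phi>a ` (spos \<Phi>a \<inter> Phi_mor X g ` (sact \<Phi>b Mns ` spos \<Phi>b)))\<rparr>"

definition is_principal_sgs :: "('o, 'm, 'x) signed_groupoid_set \<Rightarrow> bool" where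
  "is_principal_sgs X \<longleftrightarrow>
     is_signed_groupoid_set X \<and> is_principal_set_protorootoid (sgs_set_protorootoid X)"

definition is_rootoidal_sgs :: "('o, 'm, 'x) signed_groupoid_set \<Rightarrow> bool" where
  "is_rootoidal_sgs X \<longleftrightarrow>
     is_signed_groupoid_set X \<and> is_set_rootoid (sgs_set_protorootoid X)"

definition trivially_signed :: "'x set \<Rightarrow> ('x \<times> pm) signed_set" where
  "trivially_signed A =
     \<lparr>scarrier = A \<times> UNIV, sact = (\<lambda>e (x, f). (x, pm_mult e f)), spos = A \<times> {Pls}\<rparr>"

definition frakK ::
    "('o, 'm, 'x) set_protorootoid \<Rightarrow> ('o, 'm, 'x \<times> pm) signed_groupoid_set" where
  "frakK P =
     \<lparr>SgGpd = SGpd P,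
      Phi_ob = (\<lambda>a. trivially_signed (SLam_ob P a)),
      Phi_mor = (\<lambda>g (x, e).
        (SLam_mor P g x,
         pm_mult e (if x \<in> SCoc P (gpd_inv (SGpd P) g) then Mns else Pls)))\<rparr>"

text \<open>
  A morphism \<open>(\<alpha>, \<nu>)\<close> consists of the functor \<open>\<alpha>\<close> (\<open>mor_ob\<close>, \<open>mor_mor\<close>) and the components
  \<open>\<nu>\<^sub>a : \<Psi>(\<alpha> a) \<rightarrow> \<Phi>(a)\<close> (\<open>mor_nat\<close>), which run against the direction of the functor.
\<close>

record ('o, 'm, 'x, 'p, 'n, 'y) sgs_morphism =
  mor_ob :: "'o \<Rightarrow> 'p"
  mor_mor :: "'m \<Rightarrow> 'n"
  mor_nat :: "'o \<Rightarrow> 'y \<Rightarrow> 'x"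

definition is_gpd_functor ::
    "('o, 'm) groupoid \<Rightarrow> ('p, 'n) groupoid \<Rightarrow> ('o \<Rightarrow> 'p) \<Rightarrow> ('m \<Rightarrow> 'n) \<Rightarrow> bool" where
  "is_gpd_functor G H F f \<longleftrightarrow>
     (\<forall>a\<in>Obj G. F a \<in> Obj H \<and> f (Ident G a) = Ident H (F a)) \<and>
     (\<forall>g\<in>Mor G. f g \<in> Mor H \<and> Dom H (f g) = F (Dom G g) \<and> Cod H (f g) = F (Cod G g)) \<and>
     (\<forall>g\<in>Mor G. \<forall>h\<in>Mor G. Dom G g = Cod G h \<longrightarrow> f (Comp G g h) = Comp H (f g) (f h))"

definition is_sgs_morphism ::
    "('o, 'm, 'x) signed_groupoid_set \<Rightarrow> ('p, 'n, 'y) signed_groupoid_set \<Rightarrow>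
     ('o, 'm, 'x, 'p, 'n, 'y) sgs_morphism \<Rightarrow> bool" where
  "is_sgs_morphism X Y \<mu> \<longleftrightarrow>
     is_gpd_functor (SgGpd X) (SgGpd Y) (mor_ob \<mu>) (mor_mor \<mu>) \<and>
     (\<forall>a\<in>Obj (SgGpd X).
        equivariant (Phi_ob Y (mor_ob \<mu> a)) (Phi_ob X a) (mor_nat \<mu> a) \<and>
        mor_nat \<mu> a ` spos (Phi_ob Y (mor_ob \<mu> a)) \<subseteq> spos (Phi_ob X a)) \<and>
     (\<forall>g\<in>Mor (SgGpd X). \<forall>y\<in>scarrier (Phi_ob Y (mor_ob \<mu> (Dom (SgGpd X) g))).
        mor_nat \<mu> (Cod (SgGpd X) g) (Phi_mor Y (mor_mor \<mu> g) y) =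
        Phi_mor X g (mor_nat \<mu> (Dom (SgGpd X) g) y))"

definition sgs_comp ::
    "('p, 'n, 'y, 'q, 'k, 'z) sgs_morphism \<Rightarrow> ('o, 'm, 'x, 'p, 'n, 'y) sgs_morphism \<Rightarrow>
     ('o, 'm, 'x, 'q, 'k, 'z) sgs_morphism" where
  "sgs_comp \<mu>2 \<mu>1 =
     \<lparr>mor_ob = mor_ob \<mu>2 \<circ> mor_ob \<mu>1,
      mor_mor = mor_mor \<mu>2 \<circ> mor_mor \<mu>1,
      mor_nat = (\<lambda>a. mor_nat \<mu>1 a \<circ> mor_nat \<mu>2 (mor_ob \<mu>1 a))\<rparr>"

text \<open>Being an identity morphism is tested on objects, morphisms and elements of \<open>X\<close> only.\<close>

definition is_sgs_identity ::
    "('o, 'm, 'x) signed_groupoid_set \<Rightarrow> ('o, 'm, 'x, 'o, 'm, 'x) sgs_morphism \<Rightarrow> bool" where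
  "is_sgs_identity X \<mu> \<longleftrightarrow>
     (\<forall>a\<in>Obj (SgGpd X). mor_ob \<mu> a = a) \<and>
     (\<forall>g\<in>Mor (SgGpd X). mor_mor \<mu> g = g) \<and>
     (\<forall>a\<in>Obj (SgGpd X). \<forall>x\<in>scarrier (Phi_ob X a). mor_nat \<mu> a x = x)"

definition sgs_isomorphic ::
    "('o, 'm, 'x) signed_groupoid_set \<Rightarrow> ('p, 'n, 'y) signed_groupoid_set \<Rightarrow> bool" where
  "sgs_isomorphic X Y \<longleftrightarrow>
     (\<exists>\<mu> \<mu>'. is_sgs_morphism X Y \<mu> \<and> is_sgs_morphism Y X \<mu>' \<and>
        is_sgs_identity X (sgs_comp \<mu>' \<mu>) \<and> is_sgs_identity Y (sgs_comp \<mu> \<mu>'))"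


section \<open>Coxeter systems\<close>

text \<open>
  Group presentations: a letter \<open>(s, True)\<close> stands for the generator \<open>s\<close> and \<open>(s, False)\<close> for
  its formal inverse; \<open>pres_eq S R\<close> is equality, on such words, in the group
  \<open>\<langle>S | R\<rangle>\<close>.
\<close>

type_synonym 'g word = "('g \<times> bool) list"

abbreviation words :: "'g set \<Rightarrow> 'g word set" where
  "words S \<equiv> lists (S \<times> UNIV)"

inductive pres_eq :: "'g set \<Rightarrow> 'g word set \<Rightarrow> 'g word \<Rightarrow> 'g word \<Rightarrow> bool"
  for S R where
  refl: "u \<in> words S \<Longrightarrow> pres_eq S R u u"
| sym: "pres_eq S R u v \<Longrightarrow> pres_eq S R v u"
| trans: "pres_eq S R u v \<Longrightarrow> pres_eq S R v w \<Longrightarrow> pres_eq S R u w"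
| cancel: "u \<in> words S \<Longrightarrow> v \<in> words S \<Longrightarrow> s \<in> S \<Longrightarrow>
           pres_eq S R (u @ [(s, b), (s, \<not> b)] @ v) (u @ v)"
| relator: "u \<in> words S \<Longrightarrow> v \<in> words S \<Longrightarrow> r \<in> R \<Longrightarrow>
            pres_eq S R (u @ r @ v) (u @ v)"

definition word_value :: "('g, 'b) monoid_scheme \<Rightarrow> 'g word \<Rightarrow> 'g" where
  "word_value G w = foldr (\<lambda>(s, b) x. (if b then s else inv\<^bsub>G\<^esub> s) \<otimes>\<^bsub>G\<^esub> x) w \<one>\<^bsub>G\<^esub>"

text \<open>The canonical map from \<open>\<langle>S | R\<rangle>\<close> to \<open>G\<close> is an isomorphism.\<close>

definition is_presentation :: "('g, 'b) monoid_scheme \<Rightarrow> 'g set \<Rightarrow> 'g word set \<Rightarrow> bool" where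
  "is_presentation G S R \<longleftrightarrow>
     group G \<and> S \<subseteq> carrier G \<and> R \<subseteq> words S \<and> generate G S = carrier G \<and>
     (\<forall>u\<in>words S. \<forall>v\<in>words S. word_value G u = word_value G v \<longleftrightarrow> pres_eq S R u v)"

text \<open>
  \<open>group.ord\<close> is \<open>0\<close> for elements of infinite order, so the relator \<open>(st)\<^sup>m\<close> with \<open>m\<close> the order
  of \<open>st\<close> is included precisely when that order is finite.
\<close>

definition coxeter_relators :: "('g, 'b) monoid_scheme \<Rightarrow> 'g set \<Rightarrow> 'g word set" where
  "coxeter_relators W S =
     {concat (replicate (group.ord W (s \<otimes>\<^bsub>W\<^esub> t)) [(s, True), (t, True)]) | s t.
        s \<in> S \<and> t \<in> S \<and> group.ord W (s \<otimes>\<^bsub>W\<^esub> t) \<noteq> 0}"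

definition coxeter_system :: "('g, 'b) monoid_scheme \<Rightarrow> 'g set \<Rightarrow> bool" where
  "coxeter_system W S \<longleftrightarrow>
     group W \<and> S \<subseteq> carrier W \<and> (\<forall>s\<in>S. group.ord W s = 2) \<and>
     is_presentation W S (coxeter_relators W S)"

definition cox_length :: "('g, 'b) monoid_scheme \<Rightarrow> 'g set \<Rightarrow> 'g \<Rightarrow> nat" where
  "cox_length W S w =
     (LEAST n. \<exists>ss. set ss \<subseteq> S \<and> length ss = n \<and> foldr (\<otimes>\<^bsub>W\<^esub>) ss \<one>\<^bsub>W\<^esub> = w)"

definition reflections :: "('g, 'b) monoid_scheme \<Rightarrow> 'g set \<Rightarrow> 'g set" where
  "reflections W S = {w \<otimes>\<^bsub>W\<^esub> s \<otimes>\<^bsub>W\<^esub> inv\<^bsub>W\<^esub> w | w s. w \<in> carrier W \<and> s \<in> S}"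

definition reflection_cocycle :: "('g, 'b) monoid_scheme \<Rightarrow> 'g set \<Rightarrow> 'g \<Rightarrow> 'g set" where
  "reflection_cocycle W S w =
     {t \<in> reflections W S. cox_length W S (t \<otimes>\<^bsub>W\<^esub> w) < cox_length W S w}"

definition group_groupoid :: "('g, 'b) monoid_scheme \<Rightarrow> (unit, 'g) groupoid" where
  "group_groupoid W =
     \<lparr>Obj = {()}, Mor = carrier W, Dom = (\<lambda>_. ()), Cod = (\<lambda>_. ()),
      Ident = (\<lambda>_. \<one>\<^bsub>W\<^esub>), Comp = (\<otimes>\<^bsub>W\<^esub>)\<rparr>"

definition coxeter_set_protorootoid ::
    "('g, 'b) monoid_scheme \<Rightarrow> 'g set \<Rightarrow> (unit, 'g, 'g) set_protorootoid" where
  "coxeter_set_protorootoid W S =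
     \<lparr>SGpd = group_groupoid W,
      SLam_ob = (\<lambda>_. reflections W S),
      SLam_mor = (\<lambda>w t. w \<otimes>\<^bsub>W\<^esub> t \<otimes>\<^bsub>W\<^esub> inv\<^bsub>W\<^esub> w),
      SCoc = reflection_cocycle W S\<rparr>"

definition coxeter_protorootoid ::
    "('g, 'b) monoid_scheme \<Rightarrow> 'g set \<Rightarrow> (unit, 'g, 'g set) protorootoid" where
  "coxeter_protorootoid W S = powerset_protorootoid (coxeter_set_protorootoid W S)"

text \<open>
  The sign \<open>\<nu>\<close> is given by two cases, \<open>l(wt) > l(w)\<close> and \<open>l(wt) < l(w)\<close>; these are exhaustive
  because \<open>l(wt)\<close> and \<open>l(w)\<close> have different parity.
\<close>

definition coxeter_signed_groupoid_set ::
    "('g, 'b) monoid_scheme \<Rightarrow> 'g set \<Rightarrow> (unit, 'g, 'g \<times> pm) signed_groupoid_set" where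
  "coxeter_signed_groupoid_set W S =
     \<lparr>SgGpd = group_groupoid W,
      Phi_ob = (\<lambda>_. trivially_signed (reflections W S)),
      Phi_mor = (\<lambda>w (t, e).
        (w \<otimes>\<^bsub>W\<^esub> t \<otimes>\<^bsub>W\<^esub> inv\<^bsub>W\<^esub> w,
         pm_mult (if cox_length W S (w \<otimes>\<^bsub>W\<^esub> t) > cox_length W S w then Pls else Mns) e))\<rparr>"

end

theory Submission
  imports Defs
begin

text \<open>
  A word \<open>s\<^sub>1\<dots>s\<^sub>n\<close> determines the reflections \<open>s\<^sub>1\<dots>s\<^sub>i\<dots>s\<^sub>1\<close>, and the parity with which a given
  reflection occurs among them is invariant under the Coxeter relations. This yields the
  cocycle property of \<open>N\<close> and \<open>|N w| = l w\<close>.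

  All order-theoretic statements reduce to one consequence of the exchange property: if
  \<open>N v \<subseteq> N b\<close> and a simple \<open>s\<close> lies in \<open>N b\<close> but not in \<open>N v\<close>, then \<open>N v \<subseteq> N (s b)\<close>. It shows that
  a longest common lower bound is greatest, and that a simple \<open>s\<close> outside all \<open>N x\<close>, \<open>x \<in> X\<close>, lies
  outside \<open>N (\<Or>X)\<close>; the orthogonality axiom (iii) follows by cancelling simple generators. If \<open>W\<close> is
  finite, an element of maximal length has all reflections in its \<open>N\<close>, hence is a top element.
\<close>

section \<open>Reflection parity of words\<close>

definition conj_by :: "('g, 'b) monoid_scheme \<Rightarrow> 'g \<Rightarrow> 'g \<Rightarrow> 'g" where
  "conj_by G x t = x \<otimes>\<^bsub>G\<^esub> t \<otimes>\<^bsub>G\<^esub> inv\<^bsub>G\<^esub> x"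

definition group_word_value :: "('g, 'b) monoid_scheme \<Rightarrow> 'g list \<Rightarrow> 'g" where
  "group_word_value G ss = foldr (\<otimes>\<^bsub>G\<^esub>) ss \<one>\<^bsub>G\<^esub>"

text \<open>
  For a word \<open>s\<^sub>1\<dots>s\<^sub>n\<close>, the value at \<open>t\<close> is the parity of the number of indices \<open>i\<close> with
  \<open>t = s\<^sub>1\<dots>s\<^sub>i\<dots>s\<^sub>1\<close>.
\<close>

primrec refl_parity :: "('g, 'b) monoid_scheme \<Rightarrow> 'g list \<Rightarrow> 'g \<Rightarrow> bool" where
  "refl_parity G [] t = False"
| "refl_parity G (s # ss) t = ((t = s) \<noteq> refl_parity G ss (conj_by G (inv\<^bsub>G\<^esub> s) t))"

context group
begin

lemma conj_by_closed [simp]: "x \<in> carrier G \<Longrightarrow> t \<in> carrier G \<Longrightarrow> conj_by G x t \<in> carrier G"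
  by (simp add: conj_by_def)

lemma conj_by_one [simp]: "t \<in> carrier G \<Longrightarrow> conj_by G \<one> t = t"
  by (simp add: conj_by_def)

lemma conj_by_mult:
  "\<lbrakk>x \<in> carrier G; y \<in> carrier G; t \<in> carrier G\<rbrakk> \<Longrightarrow> conj_by G (x \<otimes> y) t = conj_by G x (conj_by G y t)"
  by (simp add: conj_by_def inv_mult_group m_assoc)

lemma conj_by_inv_left [simp]:
  "\<lbrakk>x \<in> carrier G; t \<in> carrier G\<rbrakk> \<Longrightarrow> conj_by G (inv x) (conj_by G x t) = t"
  by (simp flip: conj_by_mult)

lemma conj_by_inv_right [simp]:
  "\<lbrakk>x \<in> carrier G; t \<in> carrier G\<rbrakk> \<Longrightarrow> conj_by G x (conj_by G (inv x) t) = t"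
  by (simp flip: conj_by_mult)

lemma conj_by_self [simp]: "x \<in> carrier G \<Longrightarrow> conj_by G x x = x"
  by (simp add: conj_by_def m_assoc)

lemma conj_by_inv_self [simp]: "x \<in> carrier G \<Longrightarrow> conj_by G (inv x) x = x"
  using conj_by_inv_left[of x x] by simp

lemma conj_by_eq_iff:
  "\<lbrakk>x \<in> carrier G; t \<in> carrier G; u \<in> carrier G\<rbrakk> \<Longrightarrow> conj_by G x t = u \<longleftrightarrow> t = conj_by G (inv x) u"
  by (metis conj_by_inv_left conj_by_inv_right)

lemma inj_on_conj_by: "x \<in> carrier G \<Longrightarrow> A \<subseteq> carrier G \<Longrightarrow> inj_on (conj_by G x) A"
  by (rule inj_on_inverseI[where g = "conj_by G (inv x)"]) auto

lemma group_word_value_Nil [simp]: "group_word_value G [] = \<one>"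
  by (simp add: group_word_value_def)

lemma group_word_value_Cons [simp]: "group_word_value G (s # ss) = s \<otimes> group_word_value G ss"
  by (simp add: group_word_value_def)

lemma group_word_value_closed [simp]:
  "set ss \<subseteq> carrier G \<Longrightarrow> group_word_value G ss \<in> carrier G"
  by (induction ss) auto

lemma group_word_value_append [simp]:
  "set ss \<subseteq> carrier G \<Longrightarrow> set ts \<subseteq> carrier G \<Longrightarrow>
    group_word_value G (ss @ ts) = group_word_value G ss \<otimes> group_word_value G ts"
  by (induction ss) (auto simp: m_assoc)

text \<open>The reflections of \<open>ss @ ts\<close> are those of \<open>ss\<close>, followed by
  those of \<open>ts\<close> conjugated by the value of \<open>ss\<close>.\<close>

lemma refl_parity_append:
  assumes "set ss \<subseteq> carrier G" "t \<in> carrier G"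
  shows "refl_parity G (ss @ ts) t \<longleftrightarrow>
    (refl_parity G ss t \<noteq> refl_parity G ts (conj_by G (inv (group_word_value G ss)) t))"
  using assms by (induction ss arbitrary: t) (auto simp: inv_mult_group conj_by_mult)

end

lemma sum_lessThan_add:
  fixes f :: "nat \<Rightarrow> 'a :: comm_monoid_add"
  shows "(\<Sum>i<m + n. f i) = (\<Sum>i<m. f i) + (\<Sum>i<n. f (m + i))"
  by (induction n) (simp_all add: add.assoc)

locale coxeter = group W for W :: "('g, 'b) monoid_scheme" (structure) +
  fixes S :: "'g set"
  assumes coxeter_system: "coxeter_system W S"
begin

abbreviation "\<l> \<equiv> cox_length W S"
abbreviation "T \<equiv> reflections W S"
abbreviation "N \<equiv> reflection_cocycle W S"
abbreviation "cj \<equiv> conj_by W"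
abbreviation "val \<equiv> group_word_value W"
abbreviation "par \<equiv> refl_parity W"

section \<open>Generators and reflections\<close>

lemma S_sub: "S \<subseteq> carrier W"
  using coxeter_system by (simp add: coxeter_system_def)

lemma S_closed [simp]: "s \<in> S \<Longrightarrow> s \<in> carrier W"
  using S_sub by auto

lemma word_closed [simp]: "set ss \<subseteq> S \<Longrightarrow> set ss \<subseteq> carrier W"
  using S_sub by auto

lemma S_square [simp]: "s \<in> S \<Longrightarrow> s \<otimes> s = \<one>"
  using coxeter_system pow_ord_eq_1[of s]
  by (auto simp: coxeter_system_def numeral_2_eq_2)

lemma S_inv [simp]: "s \<in> S \<Longrightarrow> inv s = s"
  by (simp add: inv_equality)

lemma S_cancel [simp]: "s \<in> S \<Longrightarrow> x \<in> carrier W \<Longrightarrow> s \<otimes> (s \<otimes> x) = x"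
  by (simp flip: m_assoc)

lemma cj_S_twice [simp]: "s \<in> S \<Longrightarrow> x \<in> carrier W \<Longrightarrow> cj s (cj s x) = x"
  by (simp flip: conj_by_mult)

lemma cj_eq_gen_iff [simp]: "s \<in> S \<Longrightarrow> t \<in> carrier W \<Longrightarrow> cj s t = s \<longleftrightarrow> t = s"
  by (simp add: conj_by_eq_iff)

lemma T_closed [simp]: "t \<in> T \<Longrightarrow> t \<in> carrier W"
  by (auto simp: reflections_def)

lemma gen_mem_T [simp]:
  assumes "s \<in> S"
  shows "s \<in> T"
proof -
  have "s = \<one> \<otimes> s \<otimes> inv \<one>" using assms by simp
  with assms show ?thesis unfolding reflections_def by blast
qed

lemma T_conj: "t \<in> T \<longleftrightarrow> (\<exists>w\<in>carrier W. \<exists>s\<in>S. t = cj w s)"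
  unfolding reflections_def conj_by_def by blast

lemma T_cj [simp]: "t \<in> T \<Longrightarrow> x \<in> carrier W \<Longrightarrow> cj x t \<in> T"
  unfolding T_conj by (metis (no_types) conj_by_mult m_closed S_closed)

lemma T_square: "t \<in> T \<Longrightarrow> t \<otimes> t = \<one>"
proof -
  assume "t \<in> T"
  then obtain w s where ws: "w \<in> carrier W" "s \<in> S" "t = cj w s" by (auto simp: T_conj)
  moreover have "inv w \<otimes> (w \<otimes> x) = x" if "x \<in> carrier W" for x
    using ws that by (simp flip: m_assoc)
  ultimately show ?thesis by (simp add: conj_by_def m_assoc)
qed

lemma T_inv: "t \<in> T \<Longrightarrow> inv t = t"
  by (simp add: T_square inv_equality)

lemma T_cancel: "t \<in> T \<Longrightarrow> x \<in> carrier W \<Longrightarrow> t \<otimes> (t \<otimes> x) = x"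
  by (simp add: T_square flip: m_assoc)

section \<open>Invariance of the parity under the Coxeter relations\<close>

lemma par_relator:
  assumes "s \<in> S" "t \<in> S" "x \<in> carrier W"
  shows "par (concat (replicate k [s, t])) x \<longleftrightarrow>
    odd (\<Sum>i<2 * k. of_bool (x = (s \<otimes> t) [^] i \<otimes> s) :: nat)"
  using assms(3)
proof (induction k arbitrary: x)
  case 0
  then show ?case by simp
next
  case (Suc k)
  define r where "r = s \<otimes> t"
  have r [simp]: "r \<in> carrier W" using assms by (simp add: r_def)
  have inv_r: "inv r = t \<otimes> s" using assms by (simp add: r_def inv_mult_group)
  have sr: "s \<otimes> inv r = r \<otimes> s" using assms by (simp add: r_def inv_mult_group m_assoc)
  \<comment> \<open>Conjugation by \<open>s\<close> inverts \<open>r\<close>, so conjugation by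
    \<open>r\<close> raises the exponent in \<open>r [^] i \<otimes> s\<close> by two: peeling off
    the letters \<open>s\<close>, \<open>t\<close> shifts the index by two.\<close>
  have shift: "cj (inv r) x = r [^] i \<otimes> s \<longleftrightarrow> x = r [^] Suc (Suc i) \<otimes> s" for i :: nat
  proof -
    have "r \<otimes> r [^] i = r [^] i \<otimes> r"
      by (metis r nat_pow_Suc nat_pow_Suc2)
    then have "cj r (r [^] i \<otimes> s) = r [^] Suc (Suc i) \<otimes> s"
      using assms sr by (simp add: conj_by_def m_assoc) (simp flip: m_assoc)
    then show ?thesis
      using assms Suc.prems by (simp add: conj_by_eq_iff)
  qed
  have second: "cj s x = t \<longleftrightarrow> x = r [^] Suc 0 \<otimes> s"
    using assms Suc.prems conj_by_eq_iff[of s x t] by (simp add: r_def conj_by_def)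
  have "par (concat (replicate (Suc k) [s, t])) x \<longleftrightarrow>
      ((x = s) \<noteq> (cj s x = t)) \<noteq> par (concat (replicate k [s, t])) (cj (inv r) x)"
    using assms Suc.prems by (simp add: inv_r conj_by_mult) argo
  also have "\<dots> \<longleftrightarrow> odd (of_bool (x = r [^] (0::nat) \<otimes> s) + (of_bool (x = r [^] Suc 0 \<otimes> s) +
      (\<Sum>i<2 * k. of_bool (x = r [^] Suc (Suc i) \<otimes> s))) :: nat)"
    using Suc.IH[of "cj (inv r) x"] Suc.prems assms
    unfolding second r_def[symmetric] shift by simp
  also have "\<dots> \<longleftrightarrow> odd (\<Sum>i<2 * Suc k. of_bool (x = r [^] i \<otimes> s) :: nat)"
    by (simp add: sum.lessThan_Suc_shift del: nat_pow_Suc sum.lessThan_Suc nat_pow_0)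
  finally show ?case unfolding r_def .
qed

lemma val_alternating:
  "s \<in> S \<Longrightarrow> t \<in> S \<Longrightarrow> val (concat (replicate k [s, t])) = (s \<otimes> t) [^] k"
proof (induction k)
  case (Suc k)
  then have "val (concat (replicate (Suc k) [s, t])) = (s \<otimes> t) \<otimes> (s \<otimes> t) [^] k"
    by (simp add: m_assoc)
  with Suc.prems show ?case by (metis S_closed m_closed nat_pow_Suc2)
qed simp

text \<open>The reflections of the relator \<open>(st)\<^sup>m\<close> are \<open>(st)\<^sup>is\<close> with \<open>i < 2m\<close>, a sequence of period \<open>m\<close>.\<close>

lemma par_coxeter_relator:
  assumes "s \<in> S" "t \<in> S" "x \<in> carrier W"
  shows "\<not> par (concat (replicate (ord (s \<otimes> t)) [s, t])) x"
proof -
  have "s \<otimes> t \<in> carrier W" using assms by simp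
  \<comment> \<open>By periodicity the two halves of the sum coincide, so the total is even.\<close>
  then have "(s \<otimes> t) [^] (ord (s \<otimes> t) + i) = (s \<otimes> t) [^] i" for i
    by (simp flip: nat_pow_mult)
  then show ?thesis
    unfolding par_relator[OF assms] mult_2 sum_lessThan_add by simp
qed

text \<open>As \<open>r\<close> has value one, the conjugation that reaches \<open>v\<close> stays
  the same, and \<open>r\<close> contributes no odd reflection itself.\<close>

lemma insert_trivial_word:
  assumes "set u \<subseteq> S" "set r \<subseteq> S" "set v \<subseteq> S" "val r = \<one>" "\<forall>x\<in>carrier W. \<not> par r x"
  shows "val (u @ r @ v) = val (u @ v) \<and> (\<forall>x\<in>carrier W. par (u @ r @ v) x = par (u @ v) x)"
  using assms by (simp add: refl_parity_append)

text \<open>Generators are involutions, so a formal inverse may be read as the generator itself, and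
  \<open>map fst\<close> forgets the exponents. Both kinds of rewriting then delete a word to which
  \<open>insert_trivial_word\<close> applies.\<close>

lemma par_pres_eq:
  assumes "pres_eq S (coxeter_relators W S) u v"
  shows "set (map fst u) \<subseteq> S \<and> set (map fst v) \<subseteq> S \<and> val (map fst u) = val (map fst v) \<and>
    (\<forall>x\<in>carrier W. par (map fst u) x = par (map fst v) x)"
  using assms
proof induction
  case (cancel u v s b)
  then have uv: "set (map fst u) \<subseteq> S" "set (map fst v) \<subseteq> S" by auto
  have "val [s, s] = \<one>" "\<forall>x\<in>carrier W. \<not> par [s, s] x" using cancel(3) by auto
  then show ?case
    using insert_trivial_word[OF uv(1) _ uv(2), of "[s, s]"] uv cancel(3) by simp
next
  case (relator u v r)
  then have uv: "set (map fst u) \<subseteq> S" "set (map fst v) \<subseteq> S" by auto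
  from relator(3) obtain s t where st: "s \<in> S" "t \<in> S"
    and r: "r = concat (replicate (ord (s \<otimes> t)) [(s, True), (t, True)])"
    by (auto simp: coxeter_relators_def)
  have r': "map fst r = concat (replicate (ord (s \<otimes> t)) [s, t])"
    by (simp add: r map_concat)
  have rS: "set (map fst r) \<subseteq> S" using st by (auto simp: r')
  have "val (map fst r) = \<one>" using st by (simp add: r' val_alternating)
  moreover have "\<forall>x\<in>carrier W. \<not> par (map fst r) x"
    unfolding r' using par_coxeter_relator st by blast
  ultimately show ?case
    using insert_trivial_word[OF uv(1) rS uv(2)] uv rS by simp
qed auto

lemma val_word_value: "set ss \<subseteq> S \<Longrightarrow> word_value W (map (\<lambda>s. (s, True)) ss) = val ss"
  by (induction ss) (auto simp: word_value_def)

text \<open>Here the defining relations enter: words of equal value are connected by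
  \<open>pres_eq\<close>, along which the parity is constant.\<close>

lemma par_cong:
  assumes "set u \<subseteq> S" "set v \<subseteq> S" "val u = val v" "x \<in> carrier W"
  shows "par u x = par v x"
proof -
  let ?f = "map (\<lambda>s. (s, True))"
  have "?f u \<in> words S" "?f v \<in> words S" using assms by auto
  moreover have "word_value W (?f u) = word_value W (?f v)"
    using assms by (simp add: val_word_value)
  ultimately have "pres_eq S (coxeter_relators W S) (?f u) (?f v)"
    using coxeter_system unfolding coxeter_system_def is_presentation_def by blast
  from par_pres_eq[OF this] assms(4) show ?thesis by (simp add: comp_def)
qed

lemma ex_word:
  assumes "w \<in> carrier W"
  shows "\<exists>ss. set ss \<subseteq> S \<and> val ss = w"
proof -
  have "w \<in> generate W S"
    using assms coxeter_system by (simp add: coxeter_system_def is_presentation_def)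
  then show ?thesis
  proof induction
    case one
    have "set [] \<subseteq> S \<and> val [] = \<one>" by simp
    then show ?case by blast
  next
    case (incl s)
    then have "set [s] \<subseteq> S \<and> val [s] = s" by simp
    then show ?case by blast
  next
    case (inv s)
    then have "set [s] \<subseteq> S \<and> val [s] = inv s" by simp
    then show ?case by blast
  next
    case (eng x y)
    then obtain u v where "set u \<subseteq> S" "val u = x" "set v \<subseteq> S" "val v = y" by blast
    then have "set (u @ v) \<subseteq> S \<and> val (u @ v) = x \<otimes> y" by simp
    then show ?case by blast
  qed
qed

section \<open>Length and the deletion property\<close>

lemma length_alt: "\<l> w = (LEAST n. \<exists>ss. set ss \<subseteq> S \<and> length ss = n \<and> val ss = w)"
  by (simp add: cox_length_def group_word_value_def)

lemma ex_reduced_word: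
  assumes "w \<in> carrier W"
  obtains ss where "set ss \<subseteq> S" "length ss = \<l> w" "val ss = w"
proof -
  have "\<exists>n ss. set ss \<subseteq> S \<and> length ss = n \<and> val ss = w" using ex_word[OF assms] by blast
  from LeastI_ex[OF this] show ?thesis using that by (auto simp: length_alt)
qed

lemma length_le: "set ss \<subseteq> S \<Longrightarrow> \<l> (val ss) \<le> length ss"
  unfolding length_alt by (rule Least_le) blast

text \<open>An odd count provides a position where \<open>t\<close> occurs as a reflection, and
  multiplying by \<open>t\<close> deletes the letter there. The induction looks for this position
  from the left.\<close>

lemma deletion:
  assumes "set ss \<subseteq> S" "t \<in> carrier W" "par ss t"
  shows "\<exists>ss'. set ss' \<subseteq> S \<and> length ss' < length ss \<and> val ss' = t \<otimes> val ss"
  using assms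
proof (induction ss arbitrary: t)
  case (Cons s ss)
  show ?case
  proof (cases "t = s")
    case True
    then have "set ss \<subseteq> S \<and> length ss < length (s # ss) \<and> val ss = t \<otimes> val (s # ss)"
      using Cons.prems by simp
    then show ?thesis by blast
  next
    case False
    with Cons obtain ss' where
      "set ss' \<subseteq> S" "length ss' < length ss" "val ss' = cj s t \<otimes> val ss"
      by (metis conj_by_closed S_inv S_closed list.set_intros(1) refl_parity.simps(2)
          set_subset_Cons subset_code(1))
    then have "set (s # ss') \<subseteq> S \<and> length (s # ss') < length (s # ss) \<and>
        val (s # ss') = t \<otimes> val (s # ss)"
      using Cons.prems by (simp add: conj_by_def m_assoc)
    then show ?thesis by blast
  qed
qed simp

lemma val_rev: "set ss \<subseteq> S \<Longrightarrow> val (rev ss) = inv (val ss)"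
  by (induction ss) (auto simp: inv_mult_group)

lemma par_palindrome:
  assumes "set u \<subseteq> S" "s \<in> S"
  defines "t \<equiv> cj (val u) s"
  shows "val (u @ s # rev u) = t" "par (u @ s # rev u) t"
proof -
  have t: "t \<in> carrier W" using assms by simp
  show "val (u @ s # rev u) = t"
    using assms by (simp add: conj_by_def val_rev m_assoc)
  \<comment> \<open>Without its middle letter the word has value one, hence parity zero everywhere;
    the middle letter adds exactly the reflection \<open>t\<close>.\<close>
  have "par (u @ rev u) t = par [] t"
    using assms t by (intro par_cong) (auto simp: val_rev)
  then show "par (u @ s # rev u) t"
    using assms t by (simp add: refl_parity_append)
qed

text \<open>
  If \<open>t\<close> does not occur an odd number of times in \<open>ss\<close>, then it does in the concatenation of a
  palindromic word for \<open>t\<close> with \<open>ss\<close>, so that multiplication by \<open>t\<close> shortens \<open>t w\<close> to \<open>w\<close>.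
\<close>

lemma par_iff_shorter:
  assumes "set ss \<subseteq> S" "t \<in> T"
  shows "par ss t \<longleftrightarrow> \<l> (t \<otimes> val ss) < \<l> (val ss)"
    and "\<not> par ss t \<longleftrightarrow> \<l> (val ss) < \<l> (t \<otimes> val ss)"
proof -
  have shorter: "\<l> (t \<otimes> val u) < \<l> (val u)" if u: "set u \<subseteq> S" "par u t" for u
  proof -
    from u have "val u \<in> carrier W" by simp
    \<comment> \<open>The parity does not depend on the chosen word, so a reduced one may be taken,
      and deletion then goes below \<open>\<l> (val u)\<close>.\<close>
    then obtain r where r: "set r \<subseteq> S" "length r = \<l> (val u)" "val r = val u"
      by (rule ex_reduced_word)
    then have "par r t" using u par_cong[of u r t] assms by simp
    from deletion[OF r(1) _ this] obtain r' where
      "set r' \<subseteq> S" "length r' < length r" "val r' = t \<otimes> val r" using assms by auto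
    with r length_le[of r'] show ?thesis by simp
  qed
  have longer: "\<l> (val ss) < \<l> (t \<otimes> val ss)" if "\<not> par ss t"
  proof -
    from assms obtain w s where ws: "w \<in> carrier W" "s \<in> S" "t = cj w s" by (auto simp: T_conj)
    then obtain u where u: "set u \<subseteq> S" "val u = w" using ex_word by blast
    define p where "p = u @ s # rev u"
    have p: "set p \<subseteq> S" "val p = t" "par p t"
      using par_palindrome[OF u(1) ws(2)] u ws by (auto simp: p_def)
    \<comment> \<open>\<open>p\<close> has value \<open>t\<close>, and conjugation by
      \<open>t\<close> fixes \<open>t\<close>, so prefixing \<open>p\<close> flips the parity at
      \<open>t\<close>.\<close>
    then have "par (p @ ss) t"
      using that assms by (simp add: refl_parity_append)
    with p assms shorter[of "p @ ss"] show ?thesis by (simp add: T_cancel)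
  qed
  have "par ss t \<Longrightarrow> \<l> (t \<otimes> val ss) < \<l> (val ss)" by (rule shorter[OF assms(1)])
  with longer show "par ss t \<longleftrightarrow> \<l> (t \<otimes> val ss) < \<l> (val ss)"
    and "\<not> par ss t \<longleftrightarrow> \<l> (val ss) < \<l> (t \<otimes> val ss)"
    by linarith+
qed

section \<open>The reflection cocycle and its cardinality\<close>

lemma mem_N_iff_par: "set ss \<subseteq> S \<Longrightarrow> t \<in> T \<Longrightarrow> t \<in> N (val ss) \<longleftrightarrow> par ss t"
  unfolding reflection_cocycle_def using par_iff_shorter(1)[of ss t] by blast

lemma N_sub_T: "N w \<subseteq> T"
  by (auto simp: reflection_cocycle_def)

lemma mem_N_T: "t \<in> N w \<Longrightarrow> t \<in> T"
  by (simp add: reflection_cocycle_def)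

lemma mem_N_less: "t \<in> N w \<Longrightarrow> \<l> (t \<otimes> w) < \<l> w"
  by (auto simp: reflection_cocycle_def)

text \<open>The definition of \<open>N\<close> alone leaves the case of equal lengths open on its
  complement; the parity excludes it.\<close>

lemma not_mem_N_iff:
  assumes "w \<in> carrier W" "t \<in> T"
  shows "t \<notin> N w \<longleftrightarrow> \<l> w < \<l> (t \<otimes> w)"
  using ex_word[OF assms(1)] assms(2) mem_N_iff_par par_iff_shorter(2) by metis

text \<open>The pointwise cocycle identity: once words for \<open>x\<close> and \<open>y\<close> are
  chosen, it is \<open>refl_parity_append\<close>.\<close>

lemma mem_N_mult:
  assumes "x \<in> carrier W" "y \<in> carrier W" "t \<in> T"
  shows "t \<in> N (x \<otimes> y) \<longleftrightarrow> (t \<in> N x) \<noteq> (cj (inv x) t \<in> N y)"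
proof -
  obtain u v where "set u \<subseteq> S" "val u = x" "set v \<subseteq> S" "val v = y" using ex_word assms by metis
  with mem_N_iff_par[of u t] mem_N_iff_par[of "u @ v" t] mem_N_iff_par[of v "cj (inv x) t"] assms
  show ?thesis by (simp add: refl_parity_append)
qed

lemma N_one [simp]: "N \<one> = {}"
  using mem_N_iff_par[of "[]"] mem_N_T by auto

lemma N_gen [simp]: "s \<in> S \<Longrightarrow> N s = {s}"
  using mem_N_iff_par[of "[s]"] mem_N_T by auto

lemma N_mult:
  assumes "x \<in> carrier W" "y \<in> carrier W"
  shows "N (x \<otimes> y) = (N x - cj x ` N y) \<union> (cj x ` N y - N x)"
proof -
  have "t \<in> cj x ` N y \<longleftrightarrow> cj (inv x) t \<in> N y" if "t \<in> T" for t
    using that assms mem_N_T T_closed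
    by (metis (no_types, lifting) conj_by_inv_left conj_by_inv_right image_iff)
  moreover have "cj x ` N y \<subseteq> T" using assms mem_N_T by auto
  ultimately have "t \<in> N (x \<otimes> y) \<longleftrightarrow> t \<in> (N x - cj x ` N y) \<union> (cj x ` N y - N x)" for t
    using mem_N_mult[OF assms, of t] mem_N_T by (cases "t \<in> T") auto
  then show ?thesis by blast
qed

lemma mem_N_gen_mult:
  assumes "s \<in> S" "w \<in> carrier W" "t \<in> T"
  shows "t \<in> N (s \<otimes> w) \<longleftrightarrow> (t = s) \<noteq> (cj s t \<in> N w)"
  using mem_N_mult[of s w t] assms by simp

text \<open>Removing the first letter \<open>s\<close> of a reduced word leaves some
  \<open>v\<close> with \<open>s \<notin> N v\<close>, and the cocycle identity makes
  \<open>N w\<close> the disjoint union of \<open>{s}\<close> and the conjugate of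
  \<open>N v\<close>.\<close>

lemma N_finite_card:
  assumes "w \<in> carrier W"
  shows "finite (N w) \<and> card (N w) = \<l> w"
proof -
  have "\<forall>w\<in>carrier W. \<l> w = n \<longrightarrow> finite (N w) \<and> card (N w) = n" for n
  proof (induction n)
    case 0
    have "N w = {}" if "w \<in> carrier W" "\<l> w = 0" for w using mem_N_less that by fastforce
    then show ?case by simp
  next
    case (Suc n)
    show ?case
    proof (intro ballI impI)
      fix w assume w: "w \<in> carrier W" "\<l> w = Suc n"
      then obtain s r where r: "set (s # r) \<subseteq> S" "length (s # r) = Suc n" "val (s # r) = w"
        by (metis ex_reduced_word length_Suc_conv)
      define v where "v = val r"
      have v: "v \<in> carrier W" "w = s \<otimes> v" "s \<in> S" "s \<in> T" using r by (auto simp: v_def)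
      have "\<l> v \<le> n" using length_le[of r] r by (simp add: v_def)
      then have "\<l> v < \<l> (s \<otimes> v)" using w v by simp
      then have s: "s \<notin> N v" using not_mem_N_iff v by simp
      obtain r' where r': "set r' \<subseteq> S" "length r' = \<l> v" "val r' = v"
        using ex_reduced_word v by blast
      then have "Suc n \<le> Suc (\<l> v)" using length_le[of "s # r'"] v w by simp
      with \<open>\<l> v \<le> n\<close> have IH: "finite (N v)" "card (N v) = n" using Suc v by auto
      have "s \<notin> cj s ` N v"
      proof
        assume "s \<in> cj s ` N v"
        then obtain t where "t \<in> N v" "s = cj s t" by auto
        with s show False using v mem_N_T by (metis T_closed cj_eq_gen_iff)
      qed
      then have "N w = insert s (cj s ` N v)" using N_mult[of s v] v by auto
      moreover have "card (cj s ` N v) = n"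
        using IH v mem_N_T by (simp add: card_image inj_on_conj_by subset_iff)
      ultimately show "finite (N w) \<and> card (N w) = Suc n"
        using IH \<open>s \<notin> cj s ` N v\<close> by simp
    qed
  qed
  from this[of "\<l> w"] show ?thesis using assms by simp
qed

lemmas N_finite [simp] = N_finite_card[THEN conjunct1]
lemmas card_N = N_finite_card[THEN conjunct2]

section \<open>Prefixes, meets and joins in the weak order\<close>

lemma mem_N_carrier: "t \<in> N w \<Longrightarrow> t \<in> carrier W"
  using mem_N_T by simp

lemma card_cj_N: "x \<in> carrier W \<Longrightarrow> y \<in> carrier W \<Longrightarrow> card (cj x ` N y) = \<l> y"
  using mem_N_carrier by (simp add: card_image inj_on_conj_by subset_iff card_N)

text \<open>By \<open>N_mult\<close> the length of the product counts a symmetric difference, which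
  loses the intersection twice.\<close>

lemma length_mult:
  assumes "x \<in> carrier W" "y \<in> carrier W"
  shows "\<l> (x \<otimes> y) + 2 * card (N x \<inter> cj x ` N y) = \<l> x + \<l> y"
proof -
  let ?A = "N x" and ?B = "cj x ` N y"
  have fin: "finite ?A" "finite ?B" using assms by auto
  have "\<l> (x \<otimes> y) = card (?A - ?B) + card (?B - ?A)"
    using fin by (subst card_Un_disjoint[symmetric]) (auto simp: assms card_N simp flip: N_mult)
  moreover have "card (?A - ?B) + card (?A \<inter> ?B) = \<l> x"
    using fin card_Int_Diff[of ?A ?B] assms by (simp add: card_N)
  moreover have "card (?B - ?A) + card (?A \<inter> ?B) = \<l> y"
    using fin card_Int_Diff[of ?B ?A] assms by (simp add: card_cj_N Int_commute)
  ultimately show ?thesis by simp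
qed

lemma length_mult_le: "x \<in> carrier W \<Longrightarrow> y \<in> carrier W \<Longrightarrow> \<l> (x \<otimes> y) \<le> \<l> x + \<l> y"
  using length_mult[of x y] by simp

text \<open>The inclusion says that the intersection in \<open>length_mult\<close> is empty. Thus
  inclusion of \<open>N\<close>-sets is the prefix order on reduced expressions.\<close>

lemma prefix_iff:
  assumes "x \<in> carrier W" "y \<in> carrier W"
  shows "N x \<subseteq> N (x \<otimes> y) \<longleftrightarrow> \<l> (x \<otimes> y) = \<l> x + \<l> y"
proof -
  have "N x \<subseteq> N (x \<otimes> y) \<longleftrightarrow> N x \<inter> cj x ` N y = {}"
    unfolding N_mult[OF assms] by auto
  also have "\<dots> \<longleftrightarrow> card (N x \<inter> cj x ` N y) = 0" using assms by simp
  finally show ?thesis using length_mult[OF assms] by auto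
qed

lemma length_gen [simp]: "s \<in> S \<Longrightarrow> \<l> s = 1"
  by (simp flip: card_N)

lemma length_one [simp]: "\<l> \<one> = 0"
  by (simp flip: card_N)

lemma length_zero: "w \<in> carrier W \<Longrightarrow> \<l> w = 0 \<Longrightarrow> w = \<one>"
  by (metis ex_reduced_word group_word_value_Nil length_0_conv)

lemma length_inv [simp]: "w \<in> carrier W \<Longrightarrow> \<l> (inv w) = \<l> w"
proof -
  have "\<l> (inv w) \<le> \<l> w" if w: "w \<in> carrier W" for w
  proof -
    obtain u where "set u \<subseteq> S" "length u = \<l> w" "val u = w" using ex_reduced_word[OF w] .
    with length_le[of "rev u"] show ?thesis by (simp add: val_rev)
  qed
  from this[of w] this[of "inv w"] show "w \<in> carrier W \<Longrightarrow> \<l> (inv w) = \<l> w" by simp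
qed

text \<open>The cocycle identity gives \<open>inv x \<otimes> y\<close> and
  \<open>inv x \<otimes> x\<close> the same \<open>N\<close>, and an element with empty
  \<open>N\<close> has length zero.\<close>

lemma N_inj:
  assumes "x \<in> carrier W" "y \<in> carrier W" "N x = N y"
  shows "x = y"
proof -
  have "t \<in> N (inv x \<otimes> y) \<longleftrightarrow> t \<in> N (inv x \<otimes> x)" if "t \<in> T" for t
    using that assms by (simp only: mem_N_mult inv_closed)
  then have "N (inv x \<otimes> y) = {}" using mem_N_T assms(1) by fastforce
  then have "inv x \<otimes> y = \<one>"
    using length_zero[of "inv x \<otimes> y"] card_N[of "inv x \<otimes> y"] assms by simp
  then show ?thesis using assms by (metis inv_equality inv_inv inv_closed)
qed

lemma first_letter:
  assumes "w \<in> carrier W" "w \<noteq> \<one>"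
  obtains s where "s \<in> S" "s \<in> N w"
proof -
  obtain u where u: "set u \<subseteq> S" "length u = \<l> w" "val u = w" using ex_reduced_word assms by blast
  with assms obtain s r where [simp]: "u = s # r" by (cases u) auto
  have "s \<otimes> w = val r" using u by auto
  then have "\<l> (s \<otimes> w) < \<l> w" using length_le[of r] u by simp
  with u show ?thesis using that[of s] by (simp add: reflection_cocycle_def)
qed

section \<open>Left multiplication by a simple generator\<close>

lemma gen_mem_N_gen_mult: "s \<in> S \<Longrightarrow> w \<in> carrier W \<Longrightarrow> s \<in> N (s \<otimes> w) \<longleftrightarrow> s \<notin> N w"
  by (simp add: mem_N_gen_mult)

lemma length_gen_mult:
  assumes "s \<in> S" "w \<in> carrier W"
  shows "s \<notin> N w \<Longrightarrow> \<l> (s \<otimes> w) = Suc (\<l> w)" and "s \<in> N w \<Longrightarrow> Suc (\<l> (s \<otimes> w)) = \<l> w"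
proof -
  have *: "\<l> (s \<otimes> v) = Suc (\<l> v)" if "v \<in> carrier W" "s \<notin> N v" for v
  proof -
    have "N s \<subseteq> N (s \<otimes> v)" using that assms by (simp add: gen_mem_N_gen_mult)
    then show ?thesis using prefix_iff[of s v] that assms by simp
  qed
  show "s \<notin> N w \<Longrightarrow> \<l> (s \<otimes> w) = Suc (\<l> w)" using * assms by blast
  show "s \<in> N w \<Longrightarrow> Suc (\<l> (s \<otimes> w)) = \<l> w"
    using *[of "s \<otimes> w"] assms by (simp add: gen_mem_N_gen_mult)
qed

text \<open>Left multiplication by \<open>s\<close> toggles membership of \<open>s\<close> and
  conjugates the rest by \<open>s\<close>; the last hypothesis makes both sides toggle
  alike.\<close>

lemma N_gen_mult_mono:
  assumes "s \<in> S" "u \<in> carrier W" "v \<in> carrier W" "N u \<subseteq> N v" "s \<in> N u \<longleftrightarrow> s \<in> N v"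
  shows "N (s \<otimes> u) \<subseteq> N (s \<otimes> v)"
proof
  fix t assume t: "t \<in> N (s \<otimes> u)"
  then have "t \<in> T" by (rule mem_N_T)
  with t assms show "t \<in> N (s \<otimes> v)" by (cases "t = s") (auto simp: mem_N_gen_mult)
qed

lemma N_gen_mult_mono_iff:
  assumes "s \<in> S" "u \<in> carrier W" "v \<in> carrier W" "s \<in> N u \<longleftrightarrow> s \<in> N v"
  shows "N (s \<otimes> u) \<subseteq> N (s \<otimes> v) \<longleftrightarrow> N u \<subseteq> N v"
  using N_gen_mult_mono[of s u v] N_gen_mult_mono[of s "s \<otimes> u" "s \<otimes> v"] assms
  by (auto simp: gen_mem_N_gen_mult)

text \<open>
  Write \<open>b = v x\<close> with lengths adding. As \<open>s\<close> is not in \<open>N v\<close>, left multiplication by \<open>s\<close>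
  shortens the factor \<open>x\<close>, so \<open>v\<close> remains a prefix.
\<close>

lemma prefix_gen_mult:
  assumes "s \<in> S" "v \<in> carrier W" "b \<in> carrier W" "N v \<subseteq> N b" "s \<notin> N v" "s \<in> N b"
  shows "N v \<subseteq> N (s \<otimes> b)"
proof -
  define x where "x = inv v \<otimes> b"
  have x: "x \<in> carrier W" "b = v \<otimes> x"
    using assms by (simp_all add: x_def flip: m_assoc)
  \<comment> \<open>\<open>r\<close> is \<open>s\<close> carried past \<open>v\<close>. Since
    \<open>s\<close> is in \<open>N b\<close> but not in \<open>N v\<close>, the cocycle identity
    puts \<open>r\<close> in \<open>N x\<close>.\<close>
  define r where "r = cj (inv v) s"
  have "r \<in> N x"
    using mem_N_mult[of v x s] x assms by (simp add: r_def)
  then have r: "r \<in> carrier W" "\<l> (r \<otimes> x) < \<l> x"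
    using mem_N_less by (auto intro: mem_N_carrier)
  have "v \<otimes> r = s \<otimes> v"
    using assms by (simp add: r_def conj_by_def m_assoc) (simp flip: m_assoc)
  then have sb: "s \<otimes> b = v \<otimes> (r \<otimes> x)"
    using x r assms by (simp flip: m_assoc)
  \<comment> \<open>The product has length \<open>\<l> v + \<l> x - 1\<close>, while
    \<open>\<l> (r \<otimes> x)\<close> is at most \<open>\<l> x - 1\<close>, so the lengths must
    add.\<close>
  have "Suc (\<l> (v \<otimes> (r \<otimes> x))) = \<l> v + \<l> x"
    using length_gen_mult(2)[of s b] prefix_iff[of v x] assms x by (simp flip: sb)
  moreover have "\<l> (v \<otimes> (r \<otimes> x)) \<le> \<l> v + \<l> (r \<otimes> x)"
    using assms r x by (simp add: length_mult_le)
  ultimately show ?thesis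
    unfolding sb using r x assms by (subst prefix_iff) auto
qed

text \<open>Neither \<open>N v\<close> nor \<open>N (s \<otimes> b)\<close> contains
  \<open>s\<close>, so the inclusion from \<open>prefix_gen_mult\<close> survives multiplication by
  \<open>s\<close>.\<close>

lemma gen_mult_prefix:
  assumes "s \<in> S" "v \<in> carrier W" "b \<in> carrier W" "N v \<subseteq> N b" "s \<notin> N v" "s \<in> N b"
  shows "N (s \<otimes> v) \<subseteq> N b"
proof -
  have "N (s \<otimes> v) \<subseteq> N (s \<otimes> (s \<otimes> b))"
    using assms prefix_gen_mult[OF assms] by (intro N_gen_mult_mono) (auto simp: gen_mem_N_gen_mult)
  then show ?thesis using assms by simp
qed

section \<open>Meets\<close>

lemma length_mono:
  "\<lbrakk>u \<in> carrier W; v \<in> carrier W; N u \<subseteq> N v\<rbrakk> \<Longrightarrow> \<l> u \<le> \<l> v"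
  by (metis N_finite card_N card_mono)

text \<open>Bounds are group elements rather than values of \<open>N\<close>, so that generators act
  on them by multiplication.\<close>

definition lower_bounds :: "'g set \<Rightarrow> 'g set" where
  "lower_bounds A = {v \<in> carrier W. \<forall>a\<in>A. N v \<subseteq> N a}"

text \<open>
  A longest lower bound \<open>c\<close> contains every simple \<open>s\<close> common to all of \<open>A\<close>, since
  otherwise \<open>s c\<close> would be a longer lower bound; cancelling such an \<open>s\<close> reduces to a shorter \<open>v\<close>.
\<close>

lemma longest_lower_bound_greatest:
  assumes "A \<subseteq> carrier W" "A \<noteq> {}" "c \<in> lower_bounds A" "\<And>m. m \<in> lower_bounds A \<Longrightarrow> \<l> m \<le> \<l> c"
    and "v \<in> lower_bounds A"
  shows "N v \<subseteq> N c"
  using assms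
proof (induction "\<l> v" arbitrary: A c v)
  case 0
  then show ?case using length_zero[of v] by (simp add: lower_bounds_def)
next
  case (Suc n)
  then have v: "v \<in> carrier W" "\<And>a. a \<in> A \<Longrightarrow> N v \<subseteq> N a"
    and c: "c \<in> carrier W" "\<And>a. a \<in> A \<Longrightarrow> N c \<subseteq> N a"
    by (auto simp: lower_bounds_def)
  have "v \<noteq> \<one>" using Suc.hyps(2) by auto
  then obtain s where s: "s \<in> S" "s \<in> N v" using v first_letter by blast
  have sA: "s \<in> N a" "a \<in> carrier W" if "a \<in> A" for a
    using v(2)[OF that] s that Suc.prems(1) by auto
  have sc: "s \<in> N c"
  proof (rule ccontr)
    assume "s \<notin> N c"
    then have "N (s \<otimes> c) \<subseteq> N a" if "a \<in> A" for a
      using c s sA that by (intro gen_mult_prefix) auto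
    then have "s \<otimes> c \<in> lower_bounds A" using c s by (simp add: lower_bounds_def)
    with Suc.prems(4) have "\<l> (s \<otimes> c) \<le> \<l> c" by blast
    with \<open>s \<notin> N c\<close> show False using c s by (simp add: length_gen_mult)
  qed
  have "N (s \<otimes> v) \<subseteq> N (s \<otimes> c)"
  proof (rule Suc.hyps(1))
    show "n = \<l> (s \<otimes> v)" using length_gen_mult(2)[of s v] s v Suc.hyps(2) by simp
    show "(\<otimes>) s ` A \<subseteq> carrier W" "(\<otimes>) s ` A \<noteq> {}" using s sA Suc.prems(2) by auto
    have "s \<otimes> u \<in> lower_bounds ((\<otimes>) s ` A)"
      if "u \<in> carrier W" "s \<in> N u" "\<And>a. a \<in> A \<Longrightarrow> N u \<subseteq> N a" for u
      using that s sA by (auto simp: lower_bounds_def N_gen_mult_mono_iff)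
    then show "s \<otimes> c \<in> lower_bounds ((\<otimes>) s ` A)" "s \<otimes> v \<in> lower_bounds ((\<otimes>) s ` A)"
      using c v s sc by auto
  next
    \<comment> \<open>Maximality of \<open>s \<otimes> c\<close>: as \<open>s\<close> is in
      \<open>N a\<close>, it is not in \<open>N (s \<otimes> a)\<close>, hence not in
      \<open>N m\<close>. So \<open>s \<otimes> m\<close> is a lower bound of \<open>A\<close> and
      longer than \<open>m\<close> by one.\<close>
    fix m assume m: "m \<in> lower_bounds ((\<otimes>) s ` A)"
    then have m': "m \<in> carrier W" by (simp add: lower_bounds_def)
    obtain a where a: "a \<in> A" using Suc.prems(2) by auto
    then have "N m \<subseteq> N (s \<otimes> a)" using m by (simp add: lower_bounds_def)
    then have "s \<notin> N m" using a s sA gen_mem_N_gen_mult[of s a] by auto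
    moreover have "N (s \<otimes> m) \<subseteq> N a" if "a \<in> A" for a
      using N_gen_mult_mono[of s m "s \<otimes> a"] m m' s sA[OF that] that \<open>s \<notin> N m\<close>
      by (simp add: lower_bounds_def gen_mem_N_gen_mult)
    then have "s \<otimes> m \<in> lower_bounds A" using m' s by (simp add: lower_bounds_def)
    then have "\<l> (s \<otimes> m) \<le> \<l> c" by (rule Suc.prems(4))
    ultimately show "\<l> m \<le> \<l> (s \<otimes> c)"
      using length_gen_mult[of s m] length_gen_mult[of s c] s sc c m' by simp
  qed
  then show ?case using s v c sc by (simp add: N_gen_mult_mono_iff)
qed

text \<open>The length of any member of \<open>A\<close> bounds the lengths of lower bounds, and
  \<open>\<one>\<close> is one of them, so a longest one exists.\<close>

lemma ex_meet:
  assumes "A \<subseteq> carrier W" "A \<noteq> {}"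
  shows "\<exists>c\<in>lower_bounds A. \<forall>v\<in>lower_bounds A. N v \<subseteq> N c"
proof -
  obtain a where a: "a \<in> A" "a \<in> carrier W" using assms by auto
  have "\<one> \<in> lower_bounds A" by (simp add: lower_bounds_def)
  moreover have "\<forall>m. m \<in> lower_bounds A \<longrightarrow> \<l> m < Suc (\<l> a)"
    using a length_mono[of _ a] by (auto simp: lower_bounds_def less_Suc_eq_le)
  ultimately obtain c where "c \<in> lower_bounds A" "\<forall>m. m \<in> lower_bounds A \<longrightarrow> \<l> m \<le> \<l> c"
    using ex_has_greatest_nat[of "\<lambda>c. c \<in> lower_bounds A" \<one> \<l> "Suc (\<l> a)"] by blast
  then show ?thesis using longest_lower_bound_greatest[OF assms] by blast
qed

section \<open>Joins and the orthogonality axiom\<close>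

definition upper_bounds :: "'g set \<Rightarrow> 'g set" where
  "upper_bounds A = {v \<in> carrier W. \<forall>a\<in>A. N a \<subseteq> N v}"

text \<open>Induction on \<open>\<l> a\<close>: a simple \<open>s\<close> in \<open>N a\<close> is
  cancelled from \<open>a\<close>, from \<open>b\<close> and from all of \<open>X\<close> at once,
  and \<open>s \<otimes> b\<close> is again a least upper bound of the translated family.\<close>

lemma join_orthogonal:
  assumes "X \<subseteq> carrier W" "a \<in> carrier W" "\<And>x. x \<in> X \<Longrightarrow> N x \<inter> N a = {}"
    and "b \<in> upper_bounds X" "\<And>c. c \<in> upper_bounds X \<Longrightarrow> N b \<subseteq> N c"
  shows "N b \<inter> N a = {}"
  using assms
proof (induction "\<l> a" arbitrary: a b X)
  case 0
  then show ?case using length_zero[of a] by simp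
next
  case (Suc n)
  have b: "b \<in> carrier W" "\<And>x. x \<in> X \<Longrightarrow> N x \<subseteq> N b"
    using Suc.prems(4) by (auto simp: upper_bounds_def)
  show ?case
  proof (cases "X = {}")
    \<comment> \<open>The empty join has empty \<open>N\<close>. The case stands apart because below
      a member of \<open>X\<close> is needed to see that upper bounds of the translated family
      contain \<open>s\<close>.\<close>
    case True
    then have "\<one> \<in> upper_bounds X" by (simp add: upper_bounds_def)
    with Suc.prems(5)[of \<one>] show ?thesis by auto
  next
    case False
    have "a \<noteq> \<one>" using Suc.hyps(2) by auto
    then obtain s where s: "s \<in> S" "s \<in> N a" using Suc.prems(2) first_letter by blast
    have sX: "s \<notin> N x" "x \<in> carrier W" if "x \<in> X" for x
      using Suc.prems(1) Suc.prems(3)[OF that] that s by auto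
    \<comment> \<open>Otherwise \<open>s \<otimes> b\<close> would be an upper bound that is not
      above \<open>b\<close>.\<close>
    have sb: "s \<notin> N b"
    proof
      assume "s \<in> N b"
      then have "s \<otimes> b \<in> upper_bounds X"
        using s b sX prefix_gen_mult[of s _ b] by (simp add: upper_bounds_def)
      then have "N b \<subseteq> N (s \<otimes> b)" by (rule Suc.prems(5))
      with \<open>s \<in> N b\<close> show False using s b by (auto simp: gen_mem_N_gen_mult)
    qed
    have "N (s \<otimes> b) \<inter> N (s \<otimes> a) = {}"
    proof (rule Suc.hyps(1))
      show "n = \<l> (s \<otimes> a)"
        using length_gen_mult(2)[of s a] s Suc.prems(2) Suc.hyps(2) by simp
      show "(\<otimes>) s ` X \<subseteq> carrier W" "s \<otimes> a \<in> carrier W" using s sX Suc.prems by auto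
      show "N y \<inter> N (s \<otimes> a) = {}" if "y \<in> (\<otimes>) s ` X" for y
      proof -
        from that obtain x where x: "x \<in> X" "y = s \<otimes> x" by auto
        have "\<not> (t \<in> N y \<and> t \<in> N (s \<otimes> a))" if "t \<in> T" for t
          using that x s sX Suc.prems(2) Suc.prems(3)[OF x(1)]
          by (cases "t = s") (auto simp: mem_N_gen_mult)
        then show ?thesis using mem_N_T by blast
      qed
      show "s \<otimes> b \<in> upper_bounds ((\<otimes>) s ` X)"
        using s b sb sX N_gen_mult_mono[of s _ b] by (simp add: upper_bounds_def)
    next
      \<comment> \<open>As \<open>s\<close> is in \<open>N (s \<otimes> x)\<close>, it is in
        \<open>N c\<close>, so \<open>s \<otimes> c\<close> bounds \<open>X\<close>; multiplication
        by \<open>s\<close> then carries the leastness of \<open>b\<close> over to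
        \<open>s \<otimes> b\<close>.\<close>
      fix c assume c: "c \<in> upper_bounds ((\<otimes>) s ` X)"
      then have c': "c \<in> carrier W" by (simp add: upper_bounds_def)
      obtain x where x: "x \<in> X" using False by auto
      then have "N (s \<otimes> x) \<subseteq> N c" using c by (simp add: upper_bounds_def)
      then have sc: "s \<in> N c" using x s sX gen_mem_N_gen_mult[of s x] by auto
      have "N x \<subseteq> N (s \<otimes> c)" if "x \<in> X" for x
        using N_gen_mult_mono[of s "s \<otimes> x" c] c c' s sc sX[OF that] that
        by (simp add: upper_bounds_def gen_mem_N_gen_mult)
      then have "N b \<subseteq> N (s \<otimes> c)"
        using c' s by (intro Suc.prems(5)) (simp add: upper_bounds_def)
      then show "N (s \<otimes> b) \<subseteq> N c"
        using N_gen_mult_mono[of s b "s \<otimes> c"] s b sb sc c' by (simp add: gen_mem_N_gen_mult)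
    qed
    then have "\<not> (t \<in> N b \<and> t \<in> N a)" if "t \<in> T" for t
      using that s b sb Suc.prems(2) mem_N_gen_mult[of s b "cj s t"]
        mem_N_gen_mult[of s a "cj s t"] by (cases "t = s") auto
    then show ?thesis using mem_N_T by blast
  qed
qed

section \<open>Finiteness and top elements\<close>

lemma finite_imp_top:
  assumes "finite (carrier W)"
  shows "\<exists>w\<in>carrier W. \<forall>v\<in>carrier W. N v \<subseteq> N w"
proof -
  have "Max (\<l> ` carrier W) \<in> \<l> ` carrier W" using assms by (intro Max_in) auto
  then obtain w where w: "w \<in> carrier W" "\<l> w = Max (\<l> ` carrier W)" by auto
  then have "\<forall>v\<in>carrier W. \<l> v \<le> \<l> w" using assms by simp
  have "t \<in> N w" if "t \<in> T" for t
  proof (rule ccontr)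
    assume "t \<notin> N w"
    then have "\<l> w < \<l> (t \<otimes> w)" using not_mem_N_iff w that by blast
    with w(1) that \<open>\<forall>v\<in>carrier W. \<l> v \<le> \<l> w\<close> show False by (meson T_closed leD m_closed)
  qed
  then show ?thesis using w mem_N_T by blast
qed

text \<open>\<open>N\<close> embeds the group into the subsets of the finite set
  \<open>N w\<close>.\<close>

lemma top_imp_finite:
  assumes "w \<in> carrier W" "\<And>v. v \<in> carrier W \<Longrightarrow> N v \<subseteq> N w"
  shows "finite (carrier W)"
proof (rule finite_imageD)
  show "finite (N ` carrier W)"
    using assms by (intro finite_subset[of "N ` carrier W" "Pow (N w)"]) auto
  show "inj_on N (carrier W)" by (rule inj_onI) (rule N_inj)
qed

end

section \<open>Powerset rings and group groupoids\<close>

lemma br_le_powerset_ring [simp]: "br_le (powerset_ring A) X Y \<longleftrightarrow> X \<subseteq> Y"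
  by (auto simp: br_le_def powerset_ring_def)

lemma carrier_powerset_ring [simp]: "carrier (powerset_ring A) = Pow A"
  by (simp add: powerset_ring_def)

lemma boolean_ring_powerset_ring: "boolean_ring (powerset_ring A)"
proof -
  have "abelian_group (powerset_ring A)"
  proof (rule abelian_groupI)
    fix X assume "X \<in> carrier (powerset_ring A)"
    then show "\<exists>Y\<in>carrier (powerset_ring A). Y \<oplus>\<^bsub>powerset_ring A\<^esub> X = \<zero>\<^bsub>powerset_ring A\<^esub>"
      by (intro bexI[of _ X]) (auto simp: powerset_ring_def)
  qed (auto simp: powerset_ring_def)
  moreover have "boolean_ring_axioms (powerset_ring A)"
    by unfold_locales (auto simp: powerset_ring_def)
  ultimately show ?thesis by (rule boolean_ring.intro)
qed

text \<open>The carrier is variable because the rank counts atoms of the principal ideal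
  \<open>Pow X\<close>, while simple morphisms need the atoms of the whole ring, the case
  \<open>X = A\<close>.\<close>

lemma br_atoms_powerset_ring:
  assumes "X \<subseteq> A"
  shows "br_atoms ((powerset_ring A)\<lparr>carrier := Pow X\<rparr>) = (\<lambda>x. {x}) ` X"
proof -
  have "br_atoms ((powerset_ring A)\<lparr>carrier := Pow X\<rparr>) =
      {Y. Y \<subseteq> X \<and> Y \<noteq> {} \<and> (\<forall>Z. Z \<subseteq> X \<longrightarrow> Z \<subseteq> Y \<longrightarrow> Z = {} \<or> Z = Y)}"
    by (simp add: br_atoms_def br_le_def powerset_ring_def le_iff_inf[symmetric] Ball_def)
  also have "\<dots> = (\<lambda>x. {x}) ` X"
  proof (intro subset_antisym subsetI)
    fix Y assume "Y \<in> {Y. Y \<subseteq> X \<and> Y \<noteq> {} \<and> (\<forall>Z. Z \<subseteq> X \<longrightarrow> Z \<subseteq> Y \<longrightarrow> Z = {} \<or> Z = Y)}"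
    then obtain y where "y \<in> Y" "Y \<subseteq> X" "{y} = Y" by blast
    then show "Y \<in> (\<lambda>x. {x}) ` X" by blast
  qed (auto simp: subset_singleton_iff)
  finally show ?thesis .
qed

lemma br_principal_powerset_ring: "X \<subseteq> A \<Longrightarrow> br_principal (powerset_ring A) X = Pow X"
  by (auto simp: br_principal_def powerset_ring_def)

lemma br_finite_rank_powerset_ring: "X \<subseteq> A \<Longrightarrow> br_finite_rank (powerset_ring A) X \<longleftrightarrow> finite X"
  by (simp add: br_finite_rank_def br_principal_powerset_ring)

lemma br_rank_powerset_ring: "X \<subseteq> A \<Longrightarrow> br_rank (powerset_ring A) X = card X"
  by (simp add: br_rank_def br_principal_powerset_ring br_atoms_powerset_ring card_image)

context group
begin

lemma group_groupoid_simps [simp]: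
  "Obj (group_groupoid G) = {()}" "Mor (group_groupoid G) = carrier G"
  "Dom (group_groupoid G) g = ()" "Cod (group_groupoid G) g = ()"
  "Ident (group_groupoid G) a = \<one>" "Comp (group_groupoid G) = (\<otimes>)"
  by (simp_all add: group_groupoid_def)

lemma gpd_inverse_group_groupoid:
  "g \<in> carrier G \<Longrightarrow> gpd_inverse (group_groupoid G) g h \<longleftrightarrow> h = inv g"
  by (auto simp: gpd_inverse_def intro: inv_equality[symmetric])

lemma gpd_inv_group_groupoid [simp]: "g \<in> carrier G \<Longrightarrow> gpd_inv (group_groupoid G) g = inv g"
  by (simp add: gpd_inv_def gpd_inverse_group_groupoid)

lemma is_groupoid_group_groupoid: "is_groupoid (group_groupoid G)"
  by (simp add: is_groupoid_def gpd_inverse_group_groupoid m_assoc)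

lemma product_of_group_groupoid:
  "product_of (group_groupoid G) X n g \<longleftrightarrow> (\<exists>ss. set ss \<subseteq> X \<and> length ss = n \<and> group_word_value G ss = g)"
proof
  assume "product_of (group_groupoid G) X n g"
  then show "\<exists>ss. set ss \<subseteq> X \<and> length ss = n \<and> group_word_value G ss = g"
  proof induction
    case (ident a)
    then show ?case by (intro exI[of _ "[]"]) (simp add: group_groupoid_def)
  next
    case (step x n g)
    then obtain ss where "set ss \<subseteq> X" "length ss = n" "group_word_value G ss = g" by blast
    with step(1) show ?case by (intro exI[of _ "x # ss"]) (simp add: group_groupoid_def)
  qed
next
  assume "\<exists>ss. set ss \<subseteq> X \<and> length ss = n \<and> group_word_value G ss = g"
  then obtain ss where "set ss \<subseteq> X" "length ss = n" "group_word_value G ss = g" by blast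
  then show "product_of (group_groupoid G) X n g"
  proof (induction ss arbitrary: n g)
    case Nil
    then show ?case using product_of.ident[of "()" "group_groupoid G" X]
      by (simp add: group_groupoid_def)
  next
    case (Cons s ss)
    then show ?case
      using product_of.step[of s X "group_groupoid G" "length ss" "group_word_value G ss"]
      by (auto simp: group_groupoid_def)
  qed
qed

end

lemma bounds_in_image:
  "{y. \<forall>x. x \<in> f ` A \<longrightarrow> R y x} \<inter> f ` C = f ` {v \<in> C. \<forall>a\<in>A. R (f v) (f a)}"
  by auto

section \<open>Coxeter rootoids\<close>

text \<open>
  A set protorootoid isomorphic to the one of \<open>(W, S)\<close> through a relabelling \<open>\<psi>\<close> of the
  reflections: the labels are the reflections themselves for \<open>\<C>'\<close>, and the orbits \<open>{t} \<times> {\<plusminus>}\<close>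
  for the set protorootoid of the abstract root system.
\<close>

locale relabelled_coxeter = coxeter W S
  for W :: "('g, 'b) monoid_scheme" (structure) and S :: "'g set" +
  fixes P :: "(unit, 'g, 'x) set_protorootoid" and \<psi> :: "'g \<Rightarrow> 'x"
  assumes SGpd: "SGpd P = group_groupoid W"
    and SLam_ob: "SLam_ob P a = \<psi> ` T"
    and inj_label: "inj_on \<psi> T"
    and SLam_mor: "g \<in> carrier W \<Longrightarrow> t \<in> T \<Longrightarrow> SLam_mor P g (\<psi> t) = \<psi> (cj g t)"
    and SCoc: "g \<in> carrier W \<Longrightarrow> SCoc P g = \<psi> ` N g"
begin

abbreviation "Q \<equiv> powerset_protorootoid P"

lemma Q_fields [simp]:
  "Gpd Q = group_groupoid W" "Lam_ob Q a = powerset_ring (\<psi> ` T)"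
  "Lam_mor Q g = (`) (SLam_mor P g)" "Coc Q = SCoc P"
  by (auto simp: powerset_protorootoid_def SGpd SLam_ob)

lemma is_set_functor: "is_set_functor (SGpd P) (SLam_ob P) (SLam_mor P)"
  unfolding is_set_functor_def by (auto simp: SGpd SLam_ob SLam_mor conj_by_mult)

lemma label_eqD: "\<psi> t = \<psi> u \<Longrightarrow> t \<in> T \<Longrightarrow> u \<in> T \<Longrightarrow> t = u"
  using inj_label by (rule inj_onD)

lemma inj_SLam_mor: "g \<in> carrier W \<Longrightarrow> inj_on (SLam_mor P g) (\<psi> ` T)"
  by (rule inj_onI) (auto simp: SLam_mor dest!: label_eqD, metis T_closed conj_by_inv_left)

lemma label_sub_iff: "N u \<subseteq> N v \<longleftrightarrow> \<psi> ` N u \<subseteq> \<psi> ` N v"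
proof
  assume sub: "\<psi> ` N u \<subseteq> \<psi> ` N v"
  show "N u \<subseteq> N v"
  proof
    fix t assume t: "t \<in> N u"
    with sub obtain t' where "t' \<in> N v" "\<psi> t = \<psi> t'" by blast
    with t label_eqD[of t t'] mem_N_T show "t \<in> N v" by metis
  qed
qed (rule image_mono)

lemma label_disjoint_iff: "N u \<inter> N v = {} \<longleftrightarrow> \<psi> ` N u \<inter> \<psi> ` N v = {}"
  using inj_on_image_Int[OF inj_label N_sub_T N_sub_T, of u v] by auto

lemma SLam_mor_label_image:
  assumes "g \<in> carrier W" "X \<subseteq> T"
  shows "SLam_mor P g ` \<psi> ` X = \<psi> ` cj g ` X"
  using assms SLam_mor by (force simp: image_image intro!: image_cong)

lemma is_protorootoid: "is_protorootoid Q"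
proof -
  \<comment> \<open>Images commute with intersections and differences because the action is
    injective.\<close>
  have hom: "br_hom (powerset_ring (\<psi> ` T)) (powerset_ring (\<psi> ` T)) ((`) (SLam_mor P g))"
    if g: "g \<in> carrier W" for g
  proof -
    have "SLam_mor P g ` X \<subseteq> \<psi> ` T" if "X \<subseteq> \<psi> ` T" for X
      using g that by (auto simp: SLam_mor)
    then show ?thesis
      using inj_SLam_mor[OF g]
      by (simp add: br_hom_def powerset_ring_def image_Un inj_on_image_Int
          inj_on_image_set_diff[of _ "\<psi> ` T"] Pow_iff Diff_subset[THEN subset_trans])
  qed
  have "SLam_mor P \<one> ` X = X \<and> SLam_mor P (g \<otimes> h) ` X = SLam_mor P g ` SLam_mor P h ` X"
    if "X \<subseteq> \<psi> ` T" "g \<in> carrier W" "h \<in> carrier W" for X g h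
  proof -
    from \<open>X \<subseteq> \<psi> ` T\<close> obtain Y where "X = \<psi> ` Y" "Y \<subseteq> T" by (auto simp: subset_image_iff)
    moreover have "cj (g \<otimes> h) ` Y = cj g ` cj h ` Y" "cj \<one> ` Y = Y" "cj h ` Y \<subseteq> T"
      using \<open>Y \<subseteq> T\<close> that by (force simp: conj_by_mult image_image subset_iff)+
    ultimately show ?thesis using that by (simp add: SLam_mor_label_image)
  qed
  note func = this
  have "is_br_functor (group_groupoid W) (Lam_ob Q) (Lam_mor Q)"
    using hom func func[OF _ one_closed one_closed] boolean_ring_powerset_ring
    by (simp add: is_br_functor_def)
  moreover have "SCoc P (g \<otimes> h) =
      (SCoc P g - SLam_mor P g ` SCoc P h) \<union> (SLam_mor P g ` SCoc P h - SCoc P g)"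
    if "g \<in> carrier W" "h \<in> carrier W" for g h
  proof -
    have "cj g ` N h \<subseteq> T" using that mem_N_T by auto
    then show ?thesis
      using that N_sub_T
      by (simp add: SCoc N_mult SLam_mor_label_image image_Un
          inj_on_image_set_diff[OF inj_label Diff_subset[THEN subset_trans]])
  qed
  moreover have "SCoc P g \<subseteq> \<psi> ` T" if "g \<in> carrier W" for g
    unfolding SCoc[OF that] by (rule image_mono[OF N_sub_T])
  ultimately show ?thesis
    using is_groupoid_group_groupoid by (simp add: is_protorootoid_def) (simp add: powerset_ring_def)
qed

lemma is_set_protorootoid: "is_set_protorootoid P"
  using is_groupoid_group_groupoid is_set_functor is_protorootoid
  by (simp add: is_set_protorootoid_def SGpd)

text \<open>Atoms of a powerset are singletons, and \<open>N w\<close> is a singleton exactly when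
  \<open>\<l> w = 1\<close>.\<close>

lemma simple_morphisms: "simple_morphisms Q = S"
proof -
  have *: "\<psi> ` N w \<in> (\<lambda>x. {x}) ` \<psi> ` T \<longleftrightarrow> w \<in> S" if w: "w \<in> carrier W" for w
  proof
    assume "\<psi> ` N w \<in> (\<lambda>x. {x}) ` \<psi> ` T"
    then obtain x where "\<psi> ` N w = {x}" by auto
    then have "card (N w) = 1"
      using card_image[OF inj_on_subset[OF inj_label N_sub_T], of w] by simp
    then have "\<l> w = 1" using w by (simp add: card_N)
    then obtain u where "set u \<subseteq> S" "length u = 1" "val u = w" using ex_reduced_word w by metis
    then show "w \<in> S" by (auto simp: length_Suc_conv)
  qed auto
  have "br_atoms (powerset_ring (\<psi> ` T)) = (\<lambda>x. {x}) ` \<psi> ` T"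
    using br_atoms_powerset_ring[of "\<psi> ` T" "\<psi> ` T"] by (simp add: powerset_ring_def)
  then have "simple_morphisms Q = {w \<in> carrier W. \<psi> ` N w \<in> (\<lambda>x. {x}) ` \<psi> ` T}"
    by (simp add: simple_morphisms_def SCoc cong: conj_cong)
  then have "w \<in> simple_morphisms Q \<longleftrightarrow> w \<in> S" for w
    using *[of w] S_closed[of w] by (simp only: mem_Collect_eq) argo
  then show ?thesis by auto
qed

lemma is_principal: "is_principal Q"
proof -
  \<comment> \<open>\<open>S\<close> is closed under inverses, so the groupoid length relative to
    \<open>S\<close> is the Coxeter length.\<close>
  have inv_S: "gpd_inv (group_groupoid W) ` S = S" by simp
  have "\<forall>g\<in>carrier W. \<exists>n ss. set ss \<subseteq> S \<and> length ss = n \<and> val ss = g"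
    using ex_word by blast
  then have "gpd_generates (group_groupoid W) S"
    using S_sub by (simp add: gpd_generates_def product_of_group_groupoid inv_S)
  moreover have "gpd_length (group_groupoid W) S g = \<l> g" for g
    by (simp add: gpd_length_def product_of_group_groupoid inv_S length_alt)
  moreover have "card (\<psi> ` N g) = \<l> g" if "g \<in> carrier W" for g
    using card_image[OF inj_on_subset[OF inj_label N_sub_T], of g] that by (simp add: card_N)
  moreover have "\<psi> ` N g \<subseteq> \<psi> ` T" for g using N_sub_T by blast
  ultimately show ?thesis
    using is_protorootoid
    by (simp add: is_principal_def simple_morphisms SCoc br_finite_rank_powerset_ring
        br_rank_powerset_ring)
qed

lemma weak_order_carrier: "carrier (weak_order Q a) = (\<lambda>w. \<psi> ` N w) ` carrier W"
  by (auto simp: weak_order_def star_of_def SCoc)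

lemma weak_order_le: "le (weak_order Q a) X Y \<longleftrightarrow> X \<subseteq> Y"
  by (simp add: weak_order_def)

lemma partial_order_weak_order: "partial_order (weak_order Q a)"
  by unfold_locales (auto simp: weak_order_def)

lemma carrier_subsetE:
  assumes "X \<subseteq> carrier (weak_order Q a)"
  obtains A where "A \<subseteq> carrier W" "X = (\<lambda>w. \<psi> ` N w) ` A"
  using assms unfolding weak_order_carrier by (auto simp: subset_image_iff)

lemma Lower_labels:
  assumes "A \<subseteq> carrier W"
  shows "Lower (weak_order Q a) ((\<lambda>w. \<psi> ` N w) ` A) = (\<lambda>w. \<psi> ` N w) ` lower_bounds A"
proof -
  have "(\<lambda>w. \<psi> ` N w) ` A \<inter> (\<lambda>w. \<psi> ` N w) ` carrier W = (\<lambda>w. \<psi> ` N w) ` A"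
    using assms by (intro Int_absorb2 image_mono)
  then show ?thesis
    unfolding Lower_def weak_order_carrier weak_order_le lower_bounds_def label_sub_iff
    by (simp only: bounds_in_image)
qed

lemma Upper_labels:
  assumes "A \<subseteq> carrier W"
  shows "Upper (weak_order Q a) ((\<lambda>w. \<psi> ` N w) ` A) = (\<lambda>w. \<psi> ` N w) ` upper_bounds A"
proof -
  have "(\<lambda>w. \<psi> ` N w) ` A \<inter> (\<lambda>w. \<psi> ` N w) ` carrier W = (\<lambda>w. \<psi> ` N w) ` A"
    using assms by (intro Int_absorb2 image_mono)
  then show ?thesis
    unfolding Upper_def weak_order_carrier weak_order_le upper_bounds_def label_sub_iff
    by (simp only: bounds_in_image)
qed

lemma ex_greatest_Lower:
  assumes "X \<subseteq> carrier (weak_order Q a)" "X \<noteq> {}"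
  shows "\<exists>i. greatest (weak_order Q a) i (Lower (weak_order Q a) X)"
proof -
  from assms(1) obtain A where A: "A \<subseteq> carrier W" "X = (\<lambda>w. \<psi> ` N w) ` A" by (rule carrier_subsetE)
  then obtain c where c: "c \<in> lower_bounds A" "\<forall>v\<in>lower_bounds A. N v \<subseteq> N c"
    using ex_meet[of A] assms(2) by blast
  have "Lower (weak_order Q a) X = (\<lambda>w. \<psi> ` N w) ` lower_bounds A"
    using A Lower_labels by simp
  with c have "greatest (weak_order Q a) (\<psi> ` N c) (Lower (weak_order Q a) X)"
    by (auto simp: greatest_def weak_order_carrier weak_order_le lower_bounds_def intro!: image_mono)
  then show ?thesis by blast
qed

lemma is_rootoid: "is_rootoid Q"
proof -
  have "inj_on (SCoc P) (carrier W)"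
    by (rule inj_onI) (metis N_inj SCoc label_sub_iff order_refl subset_antisym)
  moreover have "complete_meet_semilattice (weak_order Q a)" for a
    using partial_order_weak_order ex_greatest_Lower by (simp add: complete_meet_semilattice_def)
  moreover have "B \<inter> Y = {}"
    if X: "X \<subseteq> carrier (weak_order Q a)" and Y: "Y \<in> carrier (weak_order Q a)"
      and orth: "\<forall>Z\<in>X. Z \<inter> Y = {}"
      and B: "least (weak_order Q a) B (Upper (weak_order Q a) X)" for X Y B a
  proof -
    from X obtain A where A: "A \<subseteq> carrier W" "X = (\<lambda>w. \<psi> ` N w) ` A" by (rule carrier_subsetE)
    from Y obtain y where y: "y \<in> carrier W" "Y = \<psi> ` N y" by (auto simp: weak_order_carrier)
    have "Upper (weak_order Q a) X = (\<lambda>w. \<psi> ` N w) ` upper_bounds A"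
      using A Upper_labels by simp
    with B obtain b where b: "b \<in> upper_bounds A" "B = \<psi> ` N b"
      "\<And>c. c \<in> upper_bounds A \<Longrightarrow> N b \<subseteq> N c"
      by (auto simp: least_def weak_order_le simp flip: label_sub_iff)
    have "N b \<inter> N y = {}"
      using A y orth b by (intro join_orthogonal[of A y b]) (auto simp flip: label_disjoint_iff)
    then show ?thesis using b y by (simp add: label_disjoint_iff)
  qed
  ultimately show ?thesis
    unfolding is_rootoid_def using is_protorootoid
    by (auto simp: star_of_def powerset_ring_def)
qed

lemma is_complete_iff: "is_complete Q \<longleftrightarrow> finite (carrier W)"
proof
  assume "is_complete Q"
  then have "complete_lattice (weak_order Q ())" by (simp add: is_complete_def)
  then interpret complete_lattice "weak_order Q ()" .
  \<comment> \<open>The meet of the empty family is a top element.\<close>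
  obtain B where "greatest (weak_order Q ()) B (Lower (weak_order Q ()) {})"
    using inf_exists[of "{}"] by auto
  then obtain w where "w \<in> carrier W" "\<And>v. v \<in> carrier W \<Longrightarrow> N v \<subseteq> N w"
    by (auto simp: greatest_def Lower_def weak_order_carrier weak_order_le simp flip: label_sub_iff)
  then show "finite (carrier W)" by (rule top_imp_finite)
next
  assume "finite (carrier W)"
  then obtain w where w: "w \<in> carrier W" "\<forall>v\<in>carrier W. N v \<subseteq> N w" using finite_imp_top by blast
  have "complete_lattice (weak_order Q a)" for a
  proof -
    interpret partial_order "weak_order Q a" by (rule partial_order_weak_order)
    \<comment> \<open>Given a top element, meets of non-empty families suffice for
      completeness.\<close>
    have "greatest (weak_order Q a) (\<psi> ` N w) (carrier (weak_order Q a))"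
      using w by (auto simp: greatest_def weak_order_carrier weak_order_le simp flip: label_sub_iff)
    then show ?thesis using ex_greatest_Lower
      by (intro complete_lattice_criterion1) blast+
  qed
  then show "is_complete Q" by (simp add: is_complete_def)
qed

lemma is_principal_set_protorootoid: "is_principal_set_protorootoid P"
  using is_set_protorootoid is_principal by (simp add: is_principal_set_protorootoid_def)

lemma is_set_rootoid: "is_set_rootoid P"
  using is_set_protorootoid is_rootoid by (simp add: is_set_rootoid_def)

end

section \<open>Signed groupoid-sets\<close>

lemma pm_mult_simps [simp]: "pm_mult e Pls = e" "pm_mult e e = Pls"
  by (cases e; simp)+

lemma pm_mult_assoc: "pm_mult (pm_mult e f) k = pm_mult e (pm_mult f k)"
  by (cases e; cases f; cases k) auto

lemma pm_mult_commute: "pm_mult e f = pm_mult f e"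
  by (cases e; cases f) auto

lemma pm_mult_eq_self [simp]: "pm_mult e f = f \<longleftrightarrow> e = Pls"
  by (cases e; cases f) auto

lemma trivially_signed_simps [simp]:
  "scarrier (trivially_signed A) = A \<times> UNIV" "spos (trivially_signed A) = A \<times> {Pls}"
  "sact (trivially_signed A) e (x, f) = (x, pm_mult e f)"
  by (simp_all add: trivially_signed_def)

lemma sorbit_trivially_signed [simp]: "sorbit (trivially_signed A) (x, f) = {x} \<times> UNIV"
proof -
  have "(x, e) = (x, pm_mult (pm_mult e f) f)" for e by (simp add: pm_mult_assoc)
  then show ?thesis by (auto simp: sorbit_def)
qed

lemma definitely_signed_set_trivially_signed: "definitely_signed_set (trivially_signed A)"
  by (auto simp: definitely_signed_set_def pm_mult_assoc)

text \<open>Morphisms are compared only on carriers, so the identity functor with identity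
  components works in both directions.\<close>

lemma sgs_isomorphic_same_mor:
  assumes X: "is_signed_groupoid_set X" and gpd: "SgGpd Y = SgGpd X" and ob: "Phi_ob Y = Phi_ob X"
    and mor: "\<And>g x. g \<in> Mor (SgGpd X) \<Longrightarrow> x \<in> scarrier (Phi_ob X (Dom (SgGpd X) g)) \<Longrightarrow>
      Phi_mor Y g x = Phi_mor X g x"
  shows "sgs_isomorphic X Y"
proof -
  let ?\<mu> = "\<lparr>mor_ob = \<lambda>a. a, mor_mor = \<lambda>g. g, mor_nat = \<lambda>a x. x\<rparr>"
  have "is_sgs_morphism X Y ?\<mu>" "is_sgs_morphism Y X ?\<mu>"
    using X mor
    by (auto simp: is_sgs_morphism_def is_gpd_functor_def equivariant_def gpd ob
        is_signed_groupoid_set_def is_groupoid_def definitely_signed_set_def)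
  moreover have "is_sgs_identity X (sgs_comp ?\<mu> ?\<mu>)" "is_sgs_identity Y (sgs_comp ?\<mu> ?\<mu>)"
    by (simp_all add: is_sgs_identity_def sgs_comp_def)
  ultimately show ?thesis unfolding sgs_isomorphic_def by blast
qed

section \<open>Signs of the abstract root system\<close>

context coxeter
begin

abbreviation "sgn_at g t \<equiv> (if t \<in> N (inv g) then Mns else Pls)"

text \<open>\<open>t \<otimes> inv g\<close> is the inverse of \<open>g \<otimes> t\<close>, and
  inversion preserves length. This matches the sign of \<open>frakK\<close> with that of the
  abstract root system.\<close>

lemma sgn_at_alt:
  assumes "g \<in> carrier W" "t \<in> T"
  shows "sgn_at g t = (if \<l> (g \<otimes> t) > \<l> g then Pls else Mns)"
proof -
  have "\<l> (t \<otimes> inv g) = \<l> (g \<otimes> t)"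
    using assms length_inv[of "g \<otimes> t"] by (simp add: inv_mult_group T_inv)
  then show ?thesis
    using assms not_mem_N_iff[of "inv g" t] by auto
qed

lemma mem_N_inv:
  assumes "g \<in> carrier W" "t \<in> T"
  shows "t \<in> N (inv g) \<longleftrightarrow> cj g t \<in> N g"
  using mem_N_mult[of "inv g" g t] assms by simp

text \<open>The cocycle identity for \<open>inv h \<otimes> inv g\<close>, written multiplicatively;
  it makes the signed action functorial.\<close>

lemma sgn_at_mult:
  assumes "g \<in> carrier W" "h \<in> carrier W" "t \<in> T"
  shows "sgn_at (g \<otimes> h) t = pm_mult (sgn_at g (cj h t)) (sgn_at h t)"
  using mem_N_mult[of "inv h" "inv g" t] assms by (auto simp: inv_mult_group)

lemma is_signed_groupoid_set_sgn_at:
  assumes gpd: "SgGpd X = group_groupoid W" and ob: "Phi_ob X = (\<lambda>_. trivially_signed T)"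
    and mor: "\<And>g t e. g \<in> carrier W \<Longrightarrow> t \<in> T \<Longrightarrow> Phi_mor X g (t, e) = (cj g t, pm_mult e (sgn_at g t))"
  shows "is_signed_groupoid_set X"
proof -
  have "Phi_mor X (g \<otimes> h) (t, e) = Phi_mor X g (Phi_mor X h (t, e))"
    if "g \<in> carrier W" "h \<in> carrier W" "t \<in> T" for g h t e
    using that sgn_at_mult[OF that]
    by (simp add: mor conj_by_mult pm_mult_assoc pm_mult_commute del: if_split)
  then show ?thesis
    using is_groupoid_group_groupoid definitely_signed_set_trivially_signed
    by (auto simp: is_signed_groupoid_set_def is_set_functor_def equivariant_def gpd ob mor
        pm_mult_assoc)
qed

abbreviation "P\<^sub>W \<equiv> coxeter_set_protorootoid W S"

lemma frakK_simps:
  "SgGpd (frakK P\<^sub>W) = group_groupoid W" "Phi_ob (frakK P\<^sub>W) = (\<lambda>_. trivially_signed T)"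
  "g \<in> carrier W \<Longrightarrow> Phi_mor (frakK P\<^sub>W) g (t, e) = (cj g t, pm_mult e (sgn_at g t))"
  by (simp_all add: frakK_def coxeter_set_protorootoid_def conj_by_def)

lemma coxeter_signed_groupoid_set_simps:
  "SgGpd (coxeter_signed_groupoid_set W S) = group_groupoid W"
  "Phi_ob (coxeter_signed_groupoid_set W S) = (\<lambda>_. trivially_signed T)"
  "g \<in> carrier W \<Longrightarrow> t \<in> T \<Longrightarrow>
    Phi_mor (coxeter_signed_groupoid_set W S) g (t, e) = (cj g t, pm_mult e (sgn_at g t))"
  by (simp_all add: coxeter_signed_groupoid_set_def conj_by_def sgn_at_alt pm_mult_commute[of _ e])

lemma relabelled_identity: "relabelled_coxeter W S P\<^sub>W (\<lambda>t. t)"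
  by unfold_locales (auto simp: coxeter_set_protorootoid_def conj_by_def)

text \<open>Passing to \<open>frakK\<close> and back recovers the original set protorootoid, with
  each reflection replaced by its orbit of roots.\<close>

lemma relabelled_orbits:
  "relabelled_coxeter W S (sgs_set_protorootoid (frakK P\<^sub>W)) (\<lambda>t. {t} \<times> UNIV)"
proof unfold_locales
  let ?K = "frakK P\<^sub>W"
  fix g assume g: "g \<in> carrier W"
  show "SLam_mor (sgs_set_protorootoid ?K) g ({t} \<times> UNIV) = {cj g t} \<times> UNIV" if "t \<in> T" for t
  proof -
    have "(cj g t, e) = Phi_mor ?K g (t, pm_mult e (sgn_at g t))" for e
      using g by (simp only: frakK_simps pm_mult_assoc pm_mult_simps)
    then have "(cj g t, e) \<in> Phi_mor ?K g ` ({t} \<times> UNIV)" for e by blast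
    then show ?thesis
      using g by (auto simp: sgs_set_protorootoid_def frakK_simps simp del: if_split)
  qed
  \<comment> \<open>A negative root \<open>(t, Mns)\<close> becomes positive under \<open>g\<close>
    exactly when \<open>t \<in> N (inv g)\<close>, and by \<open>mem_N_inv\<close> the images
    \<open>cj g t\<close> then run through \<open>N g\<close>.\<close>
  have "Phi_mor ?K g ` (sact (trivially_signed T) Mns ` (T \<times> {Pls})) \<inter> T \<times> {Pls} = N g \<times> {Pls}"
  proof (intro subset_antisym subsetI)
    fix y assume "y \<in> N g \<times> {Pls}"
    then obtain u where u: "u \<in> N g" "u \<in> T" "y = (u, Pls)" using mem_N_T by auto
    define t where "t = cj (inv g) u"
    have t: "t \<in> T" "t \<in> N (inv g)" "cj g t = u"
      using u g by (simp_all add: t_def mem_N_inv)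
    then have "y = Phi_mor ?K g (sact (trivially_signed T) Mns (t, Pls))"
      using g u by (simp add: frakK_simps)
    with t u show "y \<in> Phi_mor ?K g ` (sact (trivially_signed T) Mns ` (T \<times> {Pls})) \<inter> T \<times> {Pls}"
      by blast
  qed (use g in \<open>auto simp: frakK_simps mem_N_inv split: if_splits\<close>)
  then show "SCoc (sgs_set_protorootoid ?K) g = (\<lambda>t. {t} \<times> UNIV) ` N g"
    by (force simp: sgs_set_protorootoid_def frakK_simps Int_commute)
qed (auto simp: sgs_set_protorootoid_def frakK_simps inj_on_def image_iff)

end

theorem theorem6p7:
  fixes W :: "('g, 'b) monoid_scheme" and S :: "'g set"
  assumes "coxeter_system W S"
  shows
    "(is_principal (coxeter_protorootoid W S)
      \<and> is_rootoid (coxeter_protorootoid W S)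
      \<and> simple_morphisms (coxeter_protorootoid W S) = S
      \<and> (is_complete (coxeter_protorootoid W S) \<longleftrightarrow> finite (carrier W)))
     \<and> (is_principal_set_protorootoid (coxeter_set_protorootoid W S)
      \<and> is_set_rootoid (coxeter_set_protorootoid W S))
     \<and> (is_principal_sgs (frakK (coxeter_set_protorootoid W S))
      \<and> is_rootoidal_sgs (frakK (coxeter_set_protorootoid W S))
      \<and> is_signed_groupoid_set (coxeter_signed_groupoid_set W S)
      \<and> sgs_isomorphic (frakK (coxeter_set_protorootoid W S)) (coxeter_signed_groupoid_set W S))"
proof -
  interpret group W using assms by (simp add: coxeter_system_def)
  interpret coxeter W S by unfold_locales (rule assms)
  interpret C: relabelled_coxeter W S "coxeter_set_protorootoid W S" "\<lambda>t. t"
    by (rule relabelled_identity)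
  \<comment> \<open>Being principal or rootoidal is defined for a signed groupoid-set through its
    set protorootoid on orbits, hence a second instance.\<close>
  interpret K: relabelled_coxeter W S
    "sgs_set_protorootoid (frakK (coxeter_set_protorootoid W S))" "\<lambda>t. {t} \<times> UNIV"
    by (rule relabelled_orbits)
  have signed: "is_signed_groupoid_set (frakK (coxeter_set_protorootoid W S))"
    "is_signed_groupoid_set (coxeter_signed_groupoid_set W S)"
    by (rule is_signed_groupoid_set_sgn_at; simp only: frakK_simps coxeter_signed_groupoid_set_simps)+
  have "sgs_isomorphic (frakK (coxeter_set_protorootoid W S)) (coxeter_signed_groupoid_set W S)"
    using signed(1)
    by (rule sgs_isomorphic_same_mor)
      (auto simp: frakK_simps coxeter_signed_groupoid_set_simps simp del: if_split)
  then show ?thesis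
    using signed C.is_principal C.is_rootoid C.simple_morphisms C.is_complete_iff
      C.is_principal_set_protorootoid C.is_set_rootoid
      K.is_principal_set_protorootoid K.is_set_rootoid
    by (simp add: coxeter_protorootoid_def is_principal_sgs_def is_rootoidal_sgs_def)
qed

end
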